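(* Let $K\subseteq\mathbb{R}^n$ be compact and let $\mathbb{I}=\{\mathbb{I}_1,\dots,\mathbb{I}_N\}$ be a random iterated function system on $K$ in which every map $S_{i,j}$ is a similarity contraction with ratio $\mathrm{Lip}(S_{i,j})\in(0,1)$. For each $i$, let $s_i$ be the unique solution of $\sum_{j\in\mathcal{I}_i}\mathrm{Lip}(S_{i,j})^{s_i}=1$, and write $s_{\min}=\min_is_i$, $s_{\max}=\max_is_i$. Assume $\mathbb{I}$ satisfies the uniform open set condition. Then (1) $0<\sup_{\omega\in\Omega}\mathcal{P}^{s_{\max}}(F_\omega)<\infty$; (2) $\sup_{\omega\in\Omega}\dim_{\mathrm P}F_\omega=\sup_{\omega\in\Omega}\overline{\dim}_{\mathrm B}F_\omega=s_{\max}$; (3) $0<\inf_{\omega\in\Omega}\mathcal{H}^{s_{\min}}(F_\omega)<\infty$; (4) $\inf_{\omega\in\Omega}\dim_{\mathrm H}F_\omega=\inf_{\omega\in\Omega}\underline{\dim}_{\mathrm B}F_\omega=s_{\min}$.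
   Context: Here $\mathbb{I}_i=\{S_{i,j}\}_{j\in\mathcal{I}_i}$ with $\mathcal{I}_i$ finite nonempty and each $S_{i,j}:K\to K$ (the restriction of) a similarity of $\mathbb{R}^n$, i.e. $|S_{i,j}x-S_{i,j}y|=\mathrm{Lip}(S_{i,j})|x-y|$. $\Omega=\{1,\dots,N\}^{\mathbb{N}}$ and for $\omega\in\Omega$, $F_\omega=\bigcap_k\bigcup_{i_1\in\mathcal{I}_{\omega_1},\dots,i_k\in\mathcal{I}_{\omega_k}}S_{\omega_1,i_1}\circ\cdots\circ S_{\omega_k,i_k}(K)$. The uniform open set condition holds if there is a nonempty open set $\mathcal{O}\subseteq K$ such that for each $i$, $\bigcup_{j\in\mathcal{I}_i}S_{i,j}(\mathcal{O})\subseteq\mathcal{O}$ with the union disjoint. $\mathcal{H}^s$, $\mathcal{P}^s$ are $s$-dimensional Hausdorff and packing measures; $\dim_{\mathrm H},\dim_{\mathrm P},\underline{\dim}_{\mathrm B},\overline{\dim}_{\mathrm B}$ are Hausdorff, packing, lower and upper box dimension. *)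

theory Defs
  imports "HOL-Analysis.Analysis" "HOL-Library.Extended_Real"
begin

text \<open>Index i ranges over 1..N; J i is the finite index set of the i-th IFS;
  S i j is the j-th map of the i-th IFS.  Omega is the set of sequences
  omega with values in 1..N (omega 0 plays the role of omega_1).\<close>

definition Omega :: "nat \<Rightarrow> (nat \<Rightarrow> nat) set" where
  "Omega N = {\<omega>. \<forall>k. \<omega> k \<in> {1..N}}"

fun rifs_comps :: "(nat \<Rightarrow> nat set) \<Rightarrow> (nat \<Rightarrow> nat \<Rightarrow> 'a \<Rightarrow> 'a) \<Rightarrow> (nat \<Rightarrow> nat) \<Rightarrow> nat \<Rightarrow> ('a \<Rightarrow> 'a) set" where
  "rifs_comps J S \<omega> 0 = {id}"
| "rifs_comps J S \<omega> (Suc k) = {f \<circ> S (\<omega> k) i | f i. f \<in> rifs_comps J S \<omega> k \<and> i \<in> J (\<omega> k)}"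

definition rifs_attractor :: "'a set \<Rightarrow> (nat \<Rightarrow> nat set) \<Rightarrow> (nat \<Rightarrow> nat \<Rightarrow> 'a \<Rightarrow> 'a) \<Rightarrow> (nat \<Rightarrow> nat) \<Rightarrow> 'a set" where
  "rifs_attractor K J S \<omega> = (\<Inter>k. \<Union>f\<in>rifs_comps J S \<omega> k. f ` K)"

definition uniform_osc :: "'a::topological_space set \<Rightarrow> nat \<Rightarrow> (nat \<Rightarrow> nat set) \<Rightarrow> (nat \<Rightarrow> nat \<Rightarrow> 'a \<Rightarrow> 'a) \<Rightarrow> bool" where
  "uniform_osc K N J S \<longleftrightarrow> (\<exists>V. open V \<and> V \<noteq> {} \<and> V \<subseteq> K \<and>
     (\<forall>i\<in>{1..N}. (\<Union>j\<in>J i. S i j ` V) \<subseteq> V \<and> disjoint_family_on (\<lambda>j. S i j ` V) (J i)))"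

definition diam_pow :: "real \<Rightarrow> 'a::metric_space set \<Rightarrow> real" where
  "diam_pow s U = (if U = {} then 0 else if s = 0 then 1 else diameter U powr s)"

definition hausdorff_pre :: "real \<Rightarrow> real \<Rightarrow> 'a::metric_space set \<Rightarrow> ennreal" where
  "hausdorff_pre s \<delta> E = (INF U \<in> {U :: nat \<Rightarrow> 'a set. E \<subseteq> (\<Union>k. U k) \<and> (\<forall>k. bounded (U k) \<and> diameter (U k) \<le> \<delta>)}.
      (\<Sum>k. ennreal (diam_pow s (U k))))"

definition hausdorff_measure :: "real \<Rightarrow> 'a::metric_space set \<Rightarrow> ennreal" where
  "hausdorff_measure s E = (SUP \<delta> \<in> {0<..}. hausdorff_pre s \<delta> E)"

definition hausdorff_dim :: "'a::metric_space set \<Rightarrow> ereal" where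
  "hausdorff_dim E = Inf {ereal s | s. 0 \<le> s \<and> hausdorff_measure s E = 0}"

definition packings :: "real \<Rightarrow> 'a::metric_space set \<Rightarrow> ('a \<times> real) set set" where
  "packings \<delta> E = {P. countable P \<and> (\<forall>p\<in>P. fst p \<in> E \<and> 0 < snd p \<and> snd p \<le> \<delta>) \<and>
      pairwise (\<lambda>p q. cball (fst p) (snd p) \<inter> cball (fst q) (snd q) = {}) P}"

definition packing_pre :: "real \<Rightarrow> 'a::metric_space set \<Rightarrow> ennreal" where
  "packing_pre s E = (INF \<delta> \<in> {0<..}. SUP P \<in> packings \<delta> E. (\<Sum>\<^sub>\<infinity>p\<in>P. ennreal ((2 * snd p) powr s)))"

definition packing_measure :: "real \<Rightarrow> 'a::metric_space set \<Rightarrow> ennreal" where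
  "packing_measure s E = (INF A \<in> {A :: nat \<Rightarrow> 'a set. E \<subseteq> (\<Union>k. A k)}. (\<Sum>k. packing_pre s (A k)))"

definition packing_dim :: "'a::metric_space set \<Rightarrow> ereal" where
  "packing_dim E = Inf {ereal s | s. 0 \<le> s \<and> packing_measure s E = 0}"

definition cover_number :: "real \<Rightarrow> 'a::metric_space set \<Rightarrow> nat" where
  "cover_number \<delta> E = (LEAST n. \<exists>U :: nat \<Rightarrow> 'a set. E \<subseteq> (\<Union>k<n. U k) \<and> (\<forall>k<n. bounded (U k) \<and> diameter (U k) \<le> \<delta>))"

definition lower_box_dim :: "'a::metric_space set \<Rightarrow> ereal" where
  "lower_box_dim E = Liminf (at_right 0) (\<lambda>\<delta>. ereal (ln (real (cover_number \<delta> E)) / - ln \<delta>))"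

definition upper_box_dim :: "'a::metric_space set \<Rightarrow> ereal" where
  "upper_box_dim E = Limsup (at_right 0) (\<lambda>\<delta>. ereal (ln (real (cover_number \<delta> E)) / - ln \<delta>))"

end

theory Submission
  imports Defs "HOL-Real_Asymp.Real_Asymp"
begin

text \<open>
  Give the cylinder of a word \<open>x\<close> of length \<open>n\<close> along \<open>\<omega>\<close> the weight
  \<open>\<Prod>k<n. r (\<omega> k) (x k) powr s (\<omega> k)\<close>, so that the cylinders of each level have total weight 1.
  If \<open>s (\<omega> k) \<le> t\<close> for all \<open>k\<close>, a cylinder of ratio \<open>\<rho>\<close> has weight at least \<open>\<rho> powr t\<close>; since disjoint
  balls centred in the attractor contain disjoint cylinders of comparable size, packing sums are
  bounded, and maximal packings by balls of equal radius turn this into upper bounds for covering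
  numbers and Hausdorff measure. If \<open>t \<le> s (\<omega> k)\<close> for all \<open>k\<close>, the weight is at most \<open>\<rho> powr t\<close>, and
  by the open set condition and a volume count only boundedly many cylinders of size about \<open>\<rho>\<close> meet
  a ball of radius \<open>\<rho>\<close>; this mass distribution bounds covering sums from below. All constants are
  independent of \<open>\<omega>\<close>. The extreme values are attained at constant \<open>\<omega>\<close>, and positivity of the
  packing measure follows because the Hausdorff premeasure is countably subadditive and
  dominated by the packing premeasure.
\<close>

section \<open>Hausdorff and packing measures\<close>

text \<open>Scaling by a finite positive constant is invertible in \<open>ennreal\<close>, so a
  constant can be pulled out of an infimum. The packing quantities are infima, and this carries
  constants through them.\<close>

lemma le_ennreal_mult_INF:
  assumes "0 < c" "\<And>i. i \<in> I \<Longrightarrow> x \<le> ennreal c * f i"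
  shows "x \<le> ennreal c * (INF i\<in>I. f i)"
proof -
  have inv: "ennreal (1 / c) * (ennreal c * y) = y" "ennreal c * (ennreal (1 / c) * y) = y" for y
    using \<open>0 < c\<close> by (auto simp: mult.assoc[symmetric] ennreal_mult[symmetric])
  have "ennreal (1 / c) * x \<le> (INF i\<in>I. f i)"
  proof (rule INF_greatest)
    fix i assume "i \<in> I"
    then have "ennreal (1 / c) * x \<le> ennreal (1 / c) * (ennreal c * f i)"
      by (intro mult_left_mono assms) auto
    then show "ennreal (1 / c) * x \<le> f i" by (simp only: inv)
  qed
  then have "ennreal c * (ennreal (1 / c) * x) \<le> ennreal c * (INF i\<in>I. f i)"
    by (intro mult_left_mono) auto
  then show ?thesis by (simp only: inv)
qed

lemma infsum_ennreal_leI: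
  fixes f :: "'i \<Rightarrow> ennreal"
  assumes "\<And>F. finite F \<Longrightarrow> F \<subseteq> A \<Longrightarrow> sum f F \<le> B"
  shows "infsum f A \<le> B"
  using assms by (subst nonneg_infsum_complete) (auto intro: SUP_least)

lemma sum_le_infsum_ennreal:
  fixes f :: "'i \<Rightarrow> ennreal"
  assumes "finite F" "F \<subseteq> A"
  shows "sum f F \<le> infsum f A"
  using assms by (subst nonneg_infsum_complete) (auto intro: SUP_upper)

lemma hausdorff_pre_le:
  assumes "E \<subseteq> (\<Union>k. U k)" "\<And>k. bounded (U k)" "\<And>k. diameter (U k) \<le> \<delta>"
  shows "hausdorff_pre s \<delta> E \<le> (\<Sum>k. ennreal (diam_pow s (U k)))"
  unfolding hausdorff_pre_def by (rule INF_lower) (use assms in auto)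

lemma hausdorff_pre_antimono:
  assumes "\<delta> \<le> \<delta>'"
  shows "hausdorff_pre s \<delta>' E \<le> hausdorff_pre s \<delta> E"
  unfolding hausdorff_pre_def
  by (rule INF_superset_mono) (use assms order_trans in blast)+

lemma hausdorff_pre_le_measure: "0 < \<delta> \<Longrightarrow> hausdorff_pre s \<delta> E \<le> hausdorff_measure s E"
  unfolding hausdorff_measure_def by (rule SUP_upper) auto

text \<open>Covers of the pieces that are optimal up to errors with total \<open>e\<close> are
  merged into one sequence through \<open>prod_decode\<close>. It is proved at fixed \<delta>
  because the lower bounds for attractors are bounds on the premeasure.\<close>

lemma hausdorff_pre_countably_subadditive:
  "hausdorff_pre s \<delta> (\<Union>k. A k) \<le> (\<Sum>k. hausdorff_pre s \<delta> (A k))"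
proof (rule ennreal_le_epsilon)
  fix e :: real assume e: "0 < e" and fin: "(\<Sum>k. hausdorff_pre s \<delta> (A k)) < top"
  have "\<exists>U. A n \<subseteq> (\<Union>k. U k) \<and> (\<forall>k. bounded (U k) \<and> diameter (U k) \<le> \<delta>) \<and>
      (\<Sum>k. ennreal (diam_pow s (U k))) \<le> hausdorff_pre s \<delta> (A n) + ennreal e * ennreal ((1/2) ^ Suc n)" for n
  proof -
    \<comment> \<open>Finiteness makes the sum with a positive error strictly larger, so some cover
      lies below it.\<close>
    have "hausdorff_pre s \<delta> (A n) < top"
      using fin by (auto simp: less_top dest!: ennreal_suminf_lessD)
    then have "hausdorff_pre s \<delta> (A n) < hausdorff_pre s \<delta> (A n) + ennreal e * ennreal ((1/2) ^ Suc n)"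
      using e by (auto simp: less_top ennreal_mult[symmetric])
    then show ?thesis
      unfolding hausdorff_pre_def INF_less_iff by (auto intro: less_imp_le)
  qed
  then obtain B where B: "\<And>n. A n \<subseteq> (\<Union>k. B n k)" "\<And>n k. bounded (B n k)" "\<And>n k. diameter (B n k) \<le> \<delta>"
    and Ble: "\<And>n. (\<Sum>k. ennreal (diam_pow s (B n k))) \<le> hausdorff_pre s \<delta> (A n) + ennreal e * ennreal ((1/2) ^ Suc n)"
    by metis
  define C where "C i = (case prod_decode i of (n, k) \<Rightarrow> B n k)" for i
  have C: "C i = B (fst (prod_decode i)) (snd (prod_decode i))" for i
    by (simp add: C_def split_def)
  have "(\<Union>n. A n) \<subseteq> (\<Union>i. C i)"
  proof clarify
    fix x n assume "x \<in> A n"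
    then obtain k where "x \<in> B n k" using B(1) by blast
    then have "x \<in> C (prod_encode (n, k))" by (simp add: C)
    then show "x \<in> (\<Union>i. C i)" by blast
  qed
  then have "hausdorff_pre s \<delta> (\<Union>k. A k) \<le> (\<Sum>i. ennreal (diam_pow s (C i)))"
    by (rule hausdorff_pre_le) (auto simp: C B)
  also have "\<dots> = (\<Sum>i. (\<lambda>(n, k). ennreal (diam_pow s (B n k))) (prod_decode i))"
    by (simp add: C split_def)
  also have "\<dots> = (\<Sum>n. \<Sum>k. ennreal (diam_pow s (B n k)))"
    by (rule suminf_ennreal_2dimen) simp
  also have "\<dots> \<le> (\<Sum>n. hausdorff_pre s \<delta> (A n) + ennreal e * ennreal ((1/2) ^ Suc n))"
    by (intro suminf_le Ble) auto
  also have "\<dots> = (\<Sum>n. hausdorff_pre s \<delta> (A n)) + (\<Sum>n. ennreal e * ennreal ((1/2) ^ Suc n))"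
    by (subst suminf_add[symmetric]) (auto simp del: ennreal_suminf_cmult)
  also have "\<dots> = (\<Sum>n. hausdorff_pre s \<delta> (A n)) + e"
    unfolding ennreal_suminf_cmult
    by (subst suminf_ennreal_eq[OF zero_le_power power_half_series]) auto
  finally show "hausdorff_pre s \<delta> (\<Union>k. A k) \<le> (\<Sum>k. hausdorff_pre s \<delta> (A k)) + ennreal e" .
qed

lemma packing_pre_mono: "A \<subseteq> B \<Longrightarrow> packing_pre s A \<le> packing_pre s B"
  unfolding packing_pre_def
  by (intro INF_mono bexI SUP_subset_mono) (auto simp: packings_def)

lemma packing_measure_le_pre: "packing_measure s E \<le> packing_pre s E"
proof -
  have "packing_pre s ({} :: 'a set) = 0"
  proof -
    have "packings \<delta> ({} :: 'a set) = {{}}" for \<delta> by (auto simp: packings_def)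
    then show ?thesis by (simp add: packing_pre_def)
  qed
  then have "(\<Sum>k. packing_pre s (if k = 0 then E else {})) = packing_pre s E"
    by (subst suminf_finite[of "{0}"]) auto
  moreover have "packing_measure s E \<le> (\<Sum>k. packing_pre s ((\<lambda>k::nat. if k = 0 then E else {}) k))"
    unfolding packing_measure_def by (rule INF_lower) (auto split: if_splits)
  ultimately show ?thesis by simp
qed

section \<open>Volume counting and maximal packings\<close>

lemma card_disjoint_balls_le:
  fixes c :: "'i \<Rightarrow> 'a::euclidean_space"
  assumes fin: "finite I" and sub: "\<And>i. i \<in> I \<Longrightarrow> ball (c i) \<eta> \<subseteq> ball u R"
    and disj: "disjoint_family_on (\<lambda>i. ball (c i) \<eta>) I" and "0 < \<eta>" "0 \<le> R"
  shows "real (card I) * \<eta> ^ DIM('a) \<le> R ^ DIM('a)"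
proof -
  let ?b = "unit_ball_vol (real DIM('a))"
  have "real (card I) * (?b * \<eta> ^ DIM('a)) = (\<Sum>i\<in>I. measure lborel (ball (c i) \<eta>))"
    using \<open>0 < \<eta>\<close> by (simp add: content_ball)
  also have "\<dots> = measure lborel (\<Union>i\<in>I. ball (c i) \<eta>)"
    by (rule measure_finite_Union[symmetric])
       (use fin disj emeasure_lborel_ball_finite in \<open>auto simp: less_top[symmetric]\<close>)
  also have "\<dots> \<le> measure lborel (ball u R)"
    by (rule measure_mono_fmeasurable) (use sub fin in \<open>auto intro!: fmeasurableI emeasure_lborel_ball_finite\<close>)
  also have "\<dots> = ?b * R ^ DIM('a)"
    using \<open>0 \<le> R\<close> by (simp add: content_ball)
  finally have "?b * (real (card I) * \<eta> ^ DIM('a)) \<le> ?b * R ^ DIM('a)"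
    by (simp add: algebra_simps)
  then show ?thesis
    by (simp add: mult_le_cancel_left_pos)
qed

text \<open>Volume bounds the number of disjoint \<delta>-balls centred in a bounded set, so a
  packing of greatest cardinality exists. A point of \<open>A\<close> outside all doubled balls
  could be added to it.\<close>

lemma finite_maximal_packing:
  fixes A :: "'a::euclidean_space set"
  assumes "bounded A" "0 < \<delta>"
  obtains T where "finite T" "T \<subseteq> A" "pairwise (\<lambda>x y. cball x \<delta> \<inter> cball y \<delta> = {}) T"
    "A \<subseteq> (\<Union>x\<in>T. cball x (2 * \<delta>))"
proof -
  define Q where "Q T \<longleftrightarrow> finite T \<and> T \<subseteq> A \<and> pairwise (\<lambda>x y. cball x \<delta> \<inter> cball y \<delta> = {}) T" for T
  obtain R where R: "0 < R" "A \<subseteq> ball 0 R"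
    using bounded_subset_ballD[OF \<open>bounded A\<close>] by blast
  \<comment> \<open>The volume ratio of a ball containing every \<delta>-ball centred in
    \<open>A\<close> to a single such ball.\<close>
  define m where "m = nat \<lceil>(R + \<delta>) ^ DIM('a) / \<delta> ^ DIM('a)\<rceil>"
  have "card T < Suc m" if "Q T" for T
  proof -
    have "disjoint_family_on (\<lambda>i. ball i \<delta>) T"
      using that ball_subset_cball unfolding Q_def pairwise_def disjoint_family_on_def by blast
    moreover have "ball x \<delta> \<subseteq> ball 0 (R + \<delta>)" if "x \<in> T" for x
      using that \<open>Q T\<close> R(2) by (subst ball_subset_ball_iff) (auto simp: Q_def)
    ultimately have "real (card T) * \<delta> ^ DIM('a) \<le> (R + \<delta>) ^ DIM('a)"
      using that R(1) \<open>0 < \<delta>\<close> by (intro card_disjoint_balls_le) (auto simp: Q_def)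
    then have "real (card T) \<le> (R + \<delta>) ^ DIM('a) / \<delta> ^ DIM('a)"
      using \<open>0 < \<delta>\<close> by (simp add: field_simps)
    then show ?thesis unfolding m_def by linarith
  qed
  moreover have "Q {}" by (auto simp: Q_def)
  ultimately have "\<exists>T. Q T \<and> (\<forall>T'. Q T' \<longrightarrow> card T' \<le> card T)"
    by (intro ex_has_greatest_nat) auto
  then obtain T where T: "Q T" "\<And>T'. Q T' \<Longrightarrow> card T' \<le> card T"
    by auto
  have "A \<subseteq> (\<Union>x\<in>T. cball x (2 * \<delta>))"
  proof (rule ccontr)
    assume "\<not> ?thesis"
    then obtain y where y: "y \<in> A" "\<And>x. x \<in> T \<Longrightarrow> dist x y > 2 * \<delta>" by force
    have sep: "cball x \<delta> \<inter> cball y \<delta> = {}" if "x \<in> T" for x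
    proof (rule ccontr)
      assume "cball x \<delta> \<inter> cball y \<delta> \<noteq> {}"
      then obtain z where "dist x z \<le> \<delta>" "dist y z \<le> \<delta>" by auto
      then have "dist x y \<le> 2 * \<delta>" using dist_triangle2[of x y z] by linarith
      with y(2)[OF that] show False by simp
    qed
    have "y \<notin> T" using y(2)[of y] \<open>0 < \<delta>\<close> by auto
    have "Q (insert y T)"
      using T(1) y(1) sep unfolding Q_def by (auto simp: pairwise_insert Int_commute)
    from T(2)[OF this] \<open>y \<notin> T\<close> T(1) show False by (simp add: Q_def)
  qed
  with T(1) show ?thesis using that unfolding Q_def by blast
qed

lemma finite_cover_enumerate:
  assumes "finite T" "A \<subseteq> (\<Union>x\<in>T. f x)"
  obtains g where "A \<subseteq> (\<Union>k<card T. f (g k))"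
proof -
  obtain g where "bij_betw g {0..<card T} T"
    using ex_bij_betw_nat_finite[OF assms(1)] by blast
  then have g: "g ` {..<card T} = T"
    by (simp add: bij_betw_def atLeast0LessThan)
  have "(\<Union>k<card T. f (g k)) = (\<Union>x\<in>g ` {..<card T}. f x)"
    by simp
  also have "\<dots> = (\<Union>x\<in>T. f x)"
    by (simp only: g)
  finally show ?thesis using that[of g] assms(2) by simp
qed

section \<open>Comparison of Hausdorff and packing measures\<close>

lemma packing_sum_finite_le:
  assumes "finite T" "T \<subseteq> A" "pairwise (\<lambda>x y. cball x \<delta> \<inter> cball y \<delta> = {}) T" "0 < \<delta>"
  shows "ennreal (real (card T) * (2 * \<delta>) powr s)
    \<le> (SUP P \<in> packings \<delta> A. (\<Sum>\<^sub>\<infinity>p\<in>P. ennreal ((2 * snd p) powr s)))"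
proof -
  let ?P = "(\<lambda>x. (x, \<delta>)) ` T"
  have "?P \<in> packings \<delta> A"
    using assms unfolding packings_def by (auto simp: pairwise_def countable_finite)
  moreover have "(\<Sum>\<^sub>\<infinity>p\<in>?P. ennreal ((2 * snd p) powr s)) = ennreal (real (card T) * (2 * \<delta>) powr s)"
    using assms(1) by (simp add: sum.reindex inj_on_def ennreal_mult ennreal_of_nat_eq_real_of_nat)
  ultimately show ?thesis by (metis (no_types, lifting) SUP_upper)
qed

lemma diam_pow_nonneg: "0 \<le> diam_pow s U"
  by (simp add: diam_pow_def)

lemma diam_pow_le:
  assumes "diameter U \<le> \<delta>" "bounded U" "0 \<le> s" "0 < \<delta>"
  shows "diam_pow s U \<le> \<delta> powr s"
  using assms by (auto simp: diam_pow_def intro!: powr_mono2 diameter_ge_0)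

lemma diameter_cball_le:
  fixes x :: "'a::euclidean_space"
  shows "0 \<le> \<delta> \<Longrightarrow> diameter (cball x \<delta>) \<le> 2 * \<delta>"
  by (simp add: diameter_cball)

text \<open>The doubled balls of a maximal packing of radius \<delta> cover \<open>A\<close> and
  have diameter at most \<open>4 * \<delta>\<close>. The factor \<open>2 powr s\<close> is the ratio
  of \<open>(4 * \<delta>) powr s\<close> to the packing term
  \<open>(2 * \<delta>) powr s\<close>.\<close>

lemma hausdorff_pre_le_packing:
  fixes A :: "'a::euclidean_space set"
  assumes "bounded A" "0 < \<delta>" "0 \<le> s"
  shows "hausdorff_pre s (4 * \<delta>) A
    \<le> ennreal (2 powr s) * (SUP P \<in> packings \<delta> A. (\<Sum>\<^sub>\<infinity>p\<in>P. ennreal ((2 * snd p) powr s)))"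
proof -
  obtain T where T: "finite T" "T \<subseteq> A" "pairwise (\<lambda>x y. cball x \<delta> \<inter> cball y \<delta> = {}) T"
    "A \<subseteq> (\<Union>x\<in>T. cball x (2 * \<delta>))"
    using finite_maximal_packing[OF assms(1,2)] .
  obtain g where g: "A \<subseteq> (\<Union>k<card T. cball (g k) (2 * \<delta>))"
    using finite_cover_enumerate[OF T(1,4)] .
  \<comment> \<open>Padding with empty sets costs nothing even for \<open>s = 0\<close>, since
    \<open>diam_pow\<close> is 0 on the empty set.\<close>
  define U where "U k = (if k < card T then cball (g k) (2 * \<delta>) else {})" for k
  have U: "bounded (U k)" "diameter (U k) \<le> 4 * \<delta>" for k
    using diameter_cball_le[of "2 * \<delta>" "g k"] assms(2) by (auto simp: U_def)
  have "hausdorff_pre s (4 * \<delta>) A \<le> (\<Sum>k. ennreal (diam_pow s (U k)))"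
  proof (rule hausdorff_pre_le)
    show "A \<subseteq> (\<Union>k. U k)"
    proof
      fix x assume "x \<in> A"
      then obtain k where "k < card T" "x \<in> cball (g k) (2 * \<delta>)"
        using g by blast
      then have "x \<in> U k" by (simp add: U_def)
      then show "x \<in> (\<Union>k. U k)" by blast
    qed
  qed (use U in auto)
  also have "\<dots> = (\<Sum>k<card T. ennreal (diam_pow s (U k)))"
    by (rule suminf_finite) (auto simp: U_def diam_pow_def)
  also have "\<dots> \<le> (\<Sum>k<card T. ennreal ((4 * \<delta>) powr s))"
    using assms U by (intro sum_mono ennreal_leI diam_pow_le) auto
  also have "\<dots> = ennreal (2 powr s) * ennreal (real (card T) * (2 * \<delta>) powr s)"
    using assms by (simp add: ennreal_mult[symmetric] ennreal_of_nat_eq_real_of_nat powr_mult[symmetric] mult_ac)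
  also have "\<dots> \<le> ennreal (2 powr s) * (SUP P \<in> packings \<delta> A. (\<Sum>\<^sub>\<infinity>p\<in>P. ennreal ((2 * snd p) powr s)))"
    by (intro mult_left_mono packing_sum_finite_le T assms) auto
  finally show ?thesis .
qed

lemma packing_sup_mono:
  assumes "\<delta> \<le> \<delta>'"
  shows "(SUP P \<in> packings \<delta> A. (\<Sum>\<^sub>\<infinity>p\<in>P. ennreal ((2 * snd p) powr s)))
    \<le> (SUP P \<in> packings \<delta>' A. (\<Sum>\<^sub>\<infinity>p\<in>P. ennreal ((2 * snd p) powr s)))"
  by (rule SUP_subset_mono) (use assms in \<open>force simp: packings_def\<close>)+

text \<open>As the scale shrinks, the Hausdorff premeasure grows and the packing supremum decreases.
  Passing to one small common scale therefore compares the two at arbitrary, unrelated scales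
  \<delta> and \<open>\<delta>'\<close>.\<close>

lemma hausdorff_measure_le_packing_pre:
  fixes A :: "'a::euclidean_space set"
  assumes "bounded A" "0 \<le> s"
  shows "hausdorff_measure s A \<le> ennreal (2 powr s) * packing_pre s A"
proof -
  have *: "hausdorff_pre s \<delta> A \<le> ennreal (2 powr s) *
      (SUP P \<in> packings \<delta>' A. (\<Sum>\<^sub>\<infinity>p\<in>P. ennreal ((2 * snd p) powr s)))"
    if "0 < \<delta>" "0 < \<delta>'" for \<delta> \<delta>'
  proof -
    define \<epsilon> where "\<epsilon> = min (\<delta> / 4) \<delta>'"
    have \<epsilon>: "0 < \<epsilon>" "4 * \<epsilon> \<le> \<delta>" "\<epsilon> \<le> \<delta>'" using that by (auto simp: \<epsilon>_def)
    have "hausdorff_pre s \<delta> A \<le> hausdorff_pre s (4 * \<epsilon>) A"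
      using \<epsilon> by (intro hausdorff_pre_antimono)
    also have "\<dots> \<le> ennreal (2 powr s) * (SUP P \<in> packings \<epsilon> A. (\<Sum>\<^sub>\<infinity>p\<in>P. ennreal ((2 * snd p) powr s)))"
      using \<epsilon> assms by (intro hausdorff_pre_le_packing)
    also have "\<dots> \<le> ennreal (2 powr s) * (SUP P \<in> packings \<delta>' A. (\<Sum>\<^sub>\<infinity>p\<in>P. ennreal ((2 * snd p) powr s)))"
      using \<epsilon> by (intro mult_left_mono packing_sup_mono) auto
    finally show ?thesis .
  qed
  have "hausdorff_measure s A \<le> ennreal (2 powr s) * (INF \<delta>'\<in>{0<..}.
      (SUP P \<in> packings \<delta>' A. (\<Sum>\<^sub>\<infinity>p\<in>P. ennreal ((2 * snd p) powr s))))"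
    unfolding hausdorff_measure_def by (intro SUP_least le_ennreal_mult_INF *) auto
  then show ?thesis
    by (simp add: packing_pre_def)
qed

text \<open>Packing measure ranges over countable covers, and subadditivity of the Hausdorff
  premeasure transfers the comparison to them. A positive lower bound on the premeasure thus makes
  the packing measure positive.\<close>

lemma hausdorff_pre_le_packing_measure:
  fixes E :: "'a::euclidean_space set"
  assumes "bounded E" "0 < \<delta>" "0 \<le> s"
  shows "hausdorff_pre s \<delta> E \<le> ennreal (2 powr s) * packing_measure s E"
proof -
  have "hausdorff_pre s \<delta> E \<le> ennreal (2 powr s) * (\<Sum>k. packing_pre s (A k))"
    if "E \<subseteq> (\<Union>k. A k)" for A :: "nat \<Rightarrow> 'a set"
  proof -
    \<comment> \<open>The sets \<open>A k\<close> may be unbounded, whereas the comparison with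
      \<open>packing_pre\<close> asks for bounded sets.\<close>
    have "hausdorff_pre s \<delta> E = hausdorff_pre s \<delta> (\<Union>k. E \<inter> A k)"
      using that by (intro arg_cong[where f = "hausdorff_pre s \<delta>"]) blast
    also have "\<dots> \<le> (\<Sum>k. hausdorff_pre s \<delta> (E \<inter> A k))"
      by (rule hausdorff_pre_countably_subadditive)
    also have "\<dots> \<le> (\<Sum>k. ennreal (2 powr s) * packing_pre s (A k))"
    proof (rule suminf_le)
      fix k
      have "hausdorff_pre s \<delta> (E \<inter> A k) \<le> hausdorff_measure s (E \<inter> A k)"
        using assms by (intro hausdorff_pre_le_measure)
      also have "\<dots> \<le> ennreal (2 powr s) * packing_pre s (E \<inter> A k)"
        using assms by (intro hausdorff_measure_le_packing_pre) (auto intro: bounded_subset)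
      also have "\<dots> \<le> ennreal (2 powr s) * packing_pre s (A k)"
        by (intro mult_left_mono packing_pre_mono) auto
      finally show "hausdorff_pre s \<delta> (E \<inter> A k) \<le> ennreal (2 powr s) * packing_pre s (A k)" .
    qed auto
    finally show ?thesis by simp
  qed
  then show ?thesis
    unfolding packing_measure_def by (intro le_ennreal_mult_INF) auto
qed

text \<open>Raising the exponent from \<open>s\<close> to \<open>t\<close> multiplies each term by
  at most \<open>(2 * \<delta>) powr (t - s)\<close>, which tends to 0 while the sums with exponent
  \<open>s\<close> stay below \<open>C\<close>.\<close>

lemma packing_pre_eq_0:
  assumes bd: "\<And>P. P \<in> packings \<delta>0 A \<Longrightarrow> (\<Sum>\<^sub>\<infinity>p\<in>P. ennreal ((2 * snd p) powr s)) \<le> ennreal C"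
    and "0 < \<delta>0" "s < t"
  shows "packing_pre t A = 0"
proof -
  have le: "packing_pre t A \<le> ennreal ((2 * \<delta>) powr (t - s)) * ennreal C" if "0 < \<delta>" "\<delta> \<le> \<delta>0" for \<delta>
  proof -
    have "packing_pre t A \<le> (SUP P \<in> packings \<delta> A. (\<Sum>\<^sub>\<infinity>p\<in>P. ennreal ((2 * snd p) powr t)))"
      unfolding packing_pre_def by (rule INF_lower) (use that in auto)
    also have "\<dots> \<le> ennreal ((2 * \<delta>) powr (t - s)) * ennreal C"
    proof (rule SUP_least)
      fix P assume P: "P \<in> packings \<delta> A"
      show "(\<Sum>\<^sub>\<infinity>p\<in>P. ennreal ((2 * snd p) powr t)) \<le> ennreal ((2 * \<delta>) powr (t - s)) * ennreal C"
      proof (rule infsum_ennreal_leI)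
        fix Q assume Q: "finite Q" "Q \<subseteq> P"
        have "(\<Sum>p\<in>Q. ennreal ((2 * snd p) powr t))
            \<le> (\<Sum>p\<in>Q. ennreal ((2 * \<delta>) powr (t - s)) * ennreal ((2 * snd p) powr s))"
        proof (rule sum_mono)
          fix p assume "p \<in> Q"
          then have p: "0 < snd p" "snd p \<le> \<delta>" using P Q by (auto simp: packings_def)
          have "(2 * snd p) powr t = (2 * snd p) powr (t - s) * (2 * snd p) powr s"
            by (simp add: powr_add[symmetric])
          also have "\<dots> \<le> (2 * \<delta>) powr (t - s) * (2 * snd p) powr s"
            using p \<open>s < t\<close> by (intro mult_right_mono powr_mono2) auto
          finally show "ennreal ((2 * snd p) powr t) \<le> ennreal ((2 * \<delta>) powr (t - s)) * ennreal ((2 * snd p) powr s)"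
            by (simp add: ennreal_mult[symmetric] ennreal_leI)
        qed
        also have "\<dots> = ennreal ((2 * \<delta>) powr (t - s)) * (\<Sum>p\<in>Q. ennreal ((2 * snd p) powr s))"
          by (rule sum_distrib_left[symmetric])
        also have "\<dots> \<le> ennreal ((2 * \<delta>) powr (t - s)) * (\<Sum>\<^sub>\<infinity>p\<in>P. ennreal ((2 * snd p) powr s))"
          by (intro mult_left_mono sum_le_infsum_ennreal Q) auto
        also have "\<dots> \<le> ennreal ((2 * \<delta>) powr (t - s)) * ennreal C"
          using P that by (intro mult_left_mono bd) (auto simp: packings_def)
        finally show "(\<Sum>p\<in>Q. ennreal ((2 * snd p) powr t)) \<le> ennreal ((2 * \<delta>) powr (t - s)) * ennreal C" .
      qed
    qed
    finally show ?thesis .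
  qed
  have "((\<lambda>\<delta>. ennreal ((2 * \<delta>) powr (t - s) * C)) \<longlongrightarrow> ennreal 0) (at_right 0)"
  proof (rule tendsto_ennrealI)
    have "0 < t - s" using \<open>s < t\<close> by simp
    then show "((\<lambda>\<delta>. (2 * \<delta>) powr (t - s) * C) \<longlongrightarrow> 0) (at_right 0)"
      by real_asymp
  qed
  moreover have "\<forall>\<^sub>F \<delta> in at_right 0. packing_pre t A \<le> ennreal ((2 * \<delta>) powr (t - s) * C)"
    using eventually_at_right_less[of 0] eventually_at_right_real[OF \<open>0 < \<delta>0\<close>]
    by eventually_elim (use le in \<open>auto simp: ennreal_mult'\<close>)
  ultimately have "packing_pre t A \<le> ennreal 0"
    by (intro tendsto_lowerbound[of _ "ennreal 0" "at_right 0"]) auto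
  then show ?thesis by simp
qed

section \<open>Covering numbers\<close>

lemma cover_number_le:
  assumes "E \<subseteq> (\<Union>x\<in>T. cball x (\<delta> / 2))" "finite T" "0 < \<delta>"
  shows "cover_number \<delta> (E :: 'a::euclidean_space set) \<le> card T"
proof -
  obtain g where "E \<subseteq> (\<Union>k<card T. cball (g k) (\<delta> / 2))"
    using finite_cover_enumerate[OF assms(2,1)] .
  then show ?thesis
    unfolding cover_number_def using assms(3) diameter_cball_le[of "\<delta> / 2"]
    by (intro Least_le exI[of _ "\<lambda>k. cball (g k) (\<delta> / 2)"]) auto
qed

text \<open>The \<open>LEAST\<close> in \<open>cover_number\<close> is attained only if some finite
  cover exists; the doubled balls of a maximal packing of radius \<open>\<delta> / 4\<close> form
  one.\<close>

lemma cover_number_cover: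
  fixes E :: "'a::euclidean_space set"
  assumes "bounded E" "0 < \<delta>"
  obtains U :: "nat \<Rightarrow> 'a set" where "E \<subseteq> (\<Union>k<cover_number \<delta> E. U k)"
    "\<And>k. k < cover_number \<delta> E \<Longrightarrow> bounded (U k)" "\<And>k. k < cover_number \<delta> E \<Longrightarrow> diameter (U k) \<le> \<delta>"
proof -
  obtain T where T: "finite T" "E \<subseteq> (\<Union>x\<in>T. cball x (2 * (\<delta> / 4)))"
    by (rule finite_maximal_packing[OF assms(1), of "\<delta> / 4"]) (use assms(2) in auto)
  obtain g where "E \<subseteq> (\<Union>k<card T. cball (g k) (2 * (\<delta> / 4)))"
    using finite_cover_enumerate[OF T] .
  then have "E \<subseteq> (\<Union>k<card T. cball (g k) (\<delta> / 2))"
    by simp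
  then have "\<exists>n. \<exists>U :: nat \<Rightarrow> 'a set. E \<subseteq> (\<Union>k<n. U k) \<and> (\<forall>k<n. bounded (U k) \<and> diameter (U k) \<le> \<delta>)"
    using assms(2) diameter_cball_le[of "\<delta> / 2"]
    by (intro exI[of _ "card T"] exI[of _ "\<lambda>k. cball (g k) (\<delta> / 2)"]) auto
  from LeastI_ex[OF this] show ?thesis
    using that unfolding cover_number_def by blast
qed

text \<open>A maximal packing of radius \<open>\<delta> / 4\<close> plays both roles: its doubled
  balls have diameter at most \<delta> and cover \<open>E\<close>, and its packing sum counts
  \<open>(\<delta> / 2) powr s\<close> for each ball.\<close>

lemma cover_number_upper:
  fixes E :: "'a::euclidean_space set"
  assumes "bounded E" and bd: "\<And>P. P \<in> packings \<delta>0 E \<Longrightarrow> (\<Sum>\<^sub>\<infinity>p\<in>P. ennreal ((2 * snd p) powr s)) \<le> ennreal C"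
    and "0 < \<delta>" "\<delta> \<le> \<delta>0" "0 \<le> C"
  shows "real (cover_number \<delta> E) * (\<delta> / 2) powr s \<le> C"
proof -
  obtain T where T: "finite T" "T \<subseteq> E" "pairwise (\<lambda>x y. cball x (\<delta> / 4) \<inter> cball y (\<delta> / 4) = {}) T"
    "E \<subseteq> (\<Union>x\<in>T. cball x (2 * (\<delta> / 4)))"
    by (rule finite_maximal_packing[OF assms(1), of "\<delta> / 4"]) (use assms(3) in auto)
  have "ennreal (real (card T) * (2 * (\<delta> / 4)) powr s)
      \<le> (SUP P \<in> packings (\<delta> / 4) E. (\<Sum>\<^sub>\<infinity>p\<in>P. ennreal ((2 * snd p) powr s)))"
    using T assms by (intro packing_sum_finite_le) auto
  also have "\<dots> \<le> ennreal C"
    using assms(3,4) by (intro SUP_least bd) (force simp: packings_def)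
  finally have "real (card T) * (\<delta> / 2) powr s \<le> C" using assms(5) by simp
  moreover have "cover_number \<delta> E \<le> card T"
    using T assms by (intro cover_number_le) auto
  ultimately show ?thesis
    by (meson mult_right_mono of_nat_mono order_trans powr_ge_zero)
qed

text \<open>A minimal cover by sets of diameter at most \<delta>, padded with empty sets, is one of
  the covers over which the premeasure is an infimum.\<close>

lemma cover_number_lower:
  fixes E :: "'a::euclidean_space set"
  assumes "bounded E" and c: "ennreal c \<le> hausdorff_pre s \<delta> E" and "0 < \<delta>" "0 \<le> s"
  shows "c \<le> real (cover_number \<delta> E) * \<delta> powr s"
proof -
  let ?n = "cover_number \<delta> E"
  obtain U where U: "E \<subseteq> (\<Union>k<?n. U k)" "\<And>k. k < ?n \<Longrightarrow> bounded (U k)" "\<And>k. k < ?n \<Longrightarrow> diameter (U k) \<le> \<delta>"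
    using cover_number_cover[OF assms(1,3)] by metis
  define U' where "U' k = (if k < ?n then U k else {})" for k
  have U': "bounded (U' k)" "diameter (U' k) \<le> \<delta>" for k
    using U assms(3) by (auto simp: U'_def)
  have "ennreal c \<le> (\<Sum>k. ennreal (diam_pow s (U' k)))"
    using U(1) U' by (intro order_trans[OF c] hausdorff_pre_le) (force simp: U'_def)+
  also have "\<dots> = (\<Sum>k<?n. ennreal (diam_pow s (U' k)))"
    by (rule suminf_finite) (auto simp: U'_def diam_pow_def)
  also have "\<dots> \<le> (\<Sum>k<?n. ennreal (\<delta> powr s))"
    using U' assms by (intro sum_mono ennreal_leI diam_pow_le) auto
  also have "\<dots> = ennreal (real ?n * \<delta> powr s)"
    by (simp add: ennreal_mult ennreal_of_nat_eq_real_of_nat)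
  finally show ?thesis by simp
qed

text \<open>Take logarithms and divide by \<open>- ln \<delta>\<close>, which is positive for
  \<delta> below 1; the constant \<open>C\<close> and the factor 1/2 vanish in the limit. Positivity
  of the covering number makes the logarithm meaningful.\<close>

lemma upper_box_dim_le:
  assumes bd: "\<And>\<delta>. 0 < \<delta> \<Longrightarrow> \<delta> \<le> \<delta>0 \<Longrightarrow> real (cover_number \<delta> E) * (\<delta> / 2) powr s \<le> C"
    and pos: "\<And>\<delta>. 0 < \<delta> \<Longrightarrow> \<delta> \<le> \<delta>0 \<Longrightarrow> 0 < cover_number \<delta> E" and "0 < \<delta>0"
  shows "upper_box_dim E \<le> ereal s"
proof -
  let ?g = "\<lambda>\<delta>::real. (ln C - s * ln (\<delta> / 2)) / - ln \<delta>"
  have "0 < min \<delta>0 1" using \<open>0 < \<delta>0\<close> by simp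
  from eventually_at_right_real[OF this]
  have "\<forall>\<^sub>F \<delta> in at_right 0. ereal (ln (real (cover_number \<delta> E)) / - ln \<delta>) \<le> ereal (?g \<delta>)"
  proof eventually_elim
    fix \<delta> :: real assume "\<delta> \<in> {0<..<min \<delta>0 1}"
    then have \<delta>: "0 < \<delta>" "\<delta> \<le> \<delta>0" "\<delta> < 1" by auto
    have p: "0 < real (cover_number \<delta> E)" using pos \<delta> by simp
    have "ln (real (cover_number \<delta> E)) + s * ln (\<delta> / 2) = ln (real (cover_number \<delta> E) * (\<delta> / 2) powr s)"
      using p \<delta> by (subst ln_mult) (auto simp: ln_powr)
    also have "\<dots> \<le> ln C"
      using bd[OF \<delta>(1,2)] p \<delta> by (intro ln_mono) auto
    finally show "ereal (ln (real (cover_number \<delta> E)) / - ln \<delta>) \<le> ereal (?g \<delta>)"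
      unfolding ereal_less_eq using \<delta> by (intro divide_right_mono) auto
  qed
  then have "upper_box_dim E \<le> Limsup (at_right 0) (\<lambda>\<delta>. ereal (?g \<delta>))"
    unfolding upper_box_dim_def by (rule Limsup_mono)
  also have "\<dots> = ereal s"
  proof (rule lim_imp_Limsup)
    have "(?g \<longlongrightarrow> s) (at_right 0)" by real_asymp
    then show "((\<lambda>\<delta>. ereal (?g \<delta>)) \<longlongrightarrow> ereal s) (at_right 0)" by (rule tendsto_ereal)
  qed auto
  finally show ?thesis .
qed

lemma lower_box_dim_ge:
  assumes bd: "\<And>\<delta>. 0 < \<delta> \<Longrightarrow> c \<le> real (cover_number \<delta> E) * \<delta> powr s" and "0 < c"
  shows "ereal s \<le> lower_box_dim E"
proof -
  let ?g = "\<lambda>\<delta>::real. (ln c - s * ln \<delta>) / - ln \<delta>"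
  have "(0::real) < 1" by simp
  from eventually_at_right_real[OF this]
  have "\<forall>\<^sub>F \<delta> in at_right 0. ereal (?g \<delta>) \<le> ereal (ln (real (cover_number \<delta> E)) / - ln \<delta>)"
  proof eventually_elim
    fix \<delta> :: real assume "\<delta> \<in> {0<..<1}"
    then have \<delta>: "0 < \<delta>" "\<delta> < 1" by auto
    have p: "0 < real (cover_number \<delta> E)" using bd[OF \<delta>(1)] \<open>0 < c\<close> by (cases "cover_number \<delta> E = 0") auto
    have "ln c \<le> ln (real (cover_number \<delta> E) * \<delta> powr s)"
      using bd[OF \<delta>(1)] \<open>0 < c\<close> by (intro ln_mono) auto
    also have "\<dots> = ln (real (cover_number \<delta> E)) + s * ln \<delta>"
      using p \<delta> by (subst ln_mult) (auto simp: ln_powr)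
    finally show "ereal (?g \<delta>) \<le> ereal (ln (real (cover_number \<delta> E)) / - ln \<delta>)"
      unfolding ereal_less_eq using \<delta> by (intro divide_right_mono) auto
  qed
  then have "Liminf (at_right 0) (\<lambda>\<delta>. ereal (?g \<delta>)) \<le> lower_box_dim E"
    unfolding lower_box_dim_def by (rule Liminf_mono)
  moreover have "Liminf (at_right 0) (\<lambda>\<delta>. ereal (?g \<delta>)) = ereal s"
  proof (rule lim_imp_Liminf)
    have "(?g \<longlongrightarrow> s) (at_right 0)" by real_asymp
    then show "((\<lambda>\<delta>. ereal (?g \<delta>)) \<longlongrightarrow> ereal s) (at_right 0)" by (rule tendsto_ereal)
  qed auto
  ultimately show ?thesis by simp
qed

lemma lower_box_dim_le_upper: "lower_box_dim E \<le> upper_box_dim E"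
  unfolding lower_box_dim_def upper_box_dim_def by (rule Liminf_le_Limsup) auto

section \<open>Words and their maps\<close>

text \<open>A word is a total function read only below \<open>n\<close>, so a prefix is the same
  function with a smaller \<open>n\<close>. Weights must be attached to words rather than to
  elements of \<open>rifs_comps\<close>, where different words with equal maps are
  identified.\<close>

primrec word_map :: "(nat \<Rightarrow> nat \<Rightarrow> 'a \<Rightarrow> 'a) \<Rightarrow> (nat \<Rightarrow> nat) \<Rightarrow> (nat \<Rightarrow> nat) \<Rightarrow> nat \<Rightarrow> 'a \<Rightarrow> 'a" where
  "word_map S \<omega> x 0 = id"
| "word_map S \<omega> x (Suc n) = word_map S \<omega> x n \<circ> S (\<omega> n) (x n)"

lemma word_map_cong: "(\<And>k. k < n \<Longrightarrow> x k = y k) \<Longrightarrow> word_map S \<omega> x n = word_map S \<omega> y n"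
  by (induction n) auto

lemma rifs_comps_eq:
  "rifs_comps J S \<omega> n = (\<lambda>x. word_map S \<omega> x n) ` (\<Pi>\<^sub>E k\<in>{..<n}. J (\<omega> k))"
proof (induction n)
  case 0
  show ?case by (simp add: fun_eq_iff)
next
  case (Suc n)
  show ?case
  proof (intro set_eqI iffI)
    fix h assume "h \<in> rifs_comps J S \<omega> (Suc n)"
    then obtain x i where x: "x \<in> (\<Pi>\<^sub>E k\<in>{..<n}. J (\<omega> k))" "i \<in> J (\<omega> n)"
      and h: "h = word_map S \<omega> x n \<circ> S (\<omega> n) i"
      using Suc by auto
    have "h = word_map S \<omega> (x(n := i)) (Suc n)"
      using word_map_cong[of n x "x(n := i)" S \<omega>] by (simp add: h)
    moreover have "x(n := i) \<in> (\<Pi>\<^sub>E k\<in>{..<Suc n}. J (\<omega> k))"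
      using x by (auto simp: PiE_iff extensional_def less_Suc_eq)
    ultimately show "h \<in> (\<lambda>x. word_map S \<omega> x (Suc n)) ` (\<Pi>\<^sub>E k\<in>{..<Suc n}. J (\<omega> k))"
      by blast
  next
    fix h assume "h \<in> (\<lambda>x. word_map S \<omega> x (Suc n)) ` (\<Pi>\<^sub>E k\<in>{..<Suc n}. J (\<omega> k))"
    then obtain x where x: "x \<in> (\<Pi>\<^sub>E k\<in>{..<Suc n}. J (\<omega> k))" and h: "h = word_map S \<omega> x (Suc n)"
      by blast
    have "word_map S \<omega> x n = word_map S \<omega> (restrict x {..<n}) n"
      by (rule word_map_cong) simp
    moreover have "restrict x {..<n} \<in> (\<Pi>\<^sub>E k\<in>{..<n}. J (\<omega> k))" "x n \<in> J (\<omega> n)"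
      using x by (auto simp: PiE_iff)
    ultimately have "word_map S \<omega> x n \<in> rifs_comps J S \<omega> n" "x n \<in> J (\<omega> n)"
      unfolding Suc by auto
    then show "h \<in> rifs_comps J S \<omega> (Suc n)"
      by (auto simp: h)
  qed
qed

text \<open>After subtracting \<open>f 0\<close>, a map scaling all distances is linear; being
  injective in finite dimension it is surjective, so the image is a whole ball.\<close>

lemma similarity_image_ball:
  fixes f :: "'a::euclidean_space \<Rightarrow> 'a"
  assumes f: "\<And>x y. dist (f x) (f y) = c * dist x y" and "0 < c"
  shows "f ` ball x a = ball (f x) (c * a)"
proof -
  define g where "g y = f y - f 0" for y
  have "linear g"
    by (rule scaling_linear[where c = c]) (use f in \<open>auto simp: g_def dist_norm\<close>)
  moreover have "inj g"
  proof (rule injI)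
    fix y z assume "g y = g z"
    then have "dist (f y) (f z) = 0" by (simp add: g_def)
    then show "y = z" using f[of y z] \<open>0 < c\<close> by simp
  qed
  ultimately have g: "surj g" by (rule linear_inj_imp_surj)
  show ?thesis
  proof (intro set_eqI iffI)
    fix z assume "z \<in> ball (f x) (c * a)"
    moreover obtain y where "z = f y"
      using g unfolding g_def surj_def by (metis diff_eq_eq diff_add_cancel)
    ultimately show "z \<in> f ` ball x a"
      using f[of x y] \<open>0 < c\<close> by auto
  qed (use f \<open>0 < c\<close> in auto)
qed

text \<open>The numbers \<open>D\<close>, \<open>p\<close> and \<open>q\<close> bound distances in
  \<open>K\<close> and all contraction ratios at once. Estimates phrased through them, and through a
  ball inside \<open>V\<close>, are uniform in the sequence \<omega>.\<close>

locale similarity_rifs =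
  fixes K :: "'a::euclidean_space set"
    and N :: nat
    and J :: "nat \<Rightarrow> nat set"
    and S :: "nat \<Rightarrow> nat \<Rightarrow> 'a \<Rightarrow> 'a"
    and r :: "nat \<Rightarrow> nat \<Rightarrow> real"
    and s :: "nat \<Rightarrow> real"
    and V :: "'a set" and D p q :: real
  assumes compact_K: "compact K"
    and finite_J: "\<And>i. i \<in> {1..N} \<Longrightarrow> finite (J i)"
    and dist_S: "\<And>i j x y. i \<in> {1..N} \<Longrightarrow> j \<in> J i \<Longrightarrow> dist (S i j x) (S i j y) = r i j * dist x y"
    and S_K: "\<And>i j. i \<in> {1..N} \<Longrightarrow> j \<in> J i \<Longrightarrow> S i j ` K \<subseteq> K"
    and sum_r: "\<And>i. i \<in> {1..N} \<Longrightarrow> (\<Sum>j\<in>J i. r i j powr s i) = 1"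
    and open_V: "open V" and V_ne: "V \<noteq> {}" and V_K: "V \<subseteq> K"
    and S_V: "\<And>i j. i \<in> {1..N} \<Longrightarrow> j \<in> J i \<Longrightarrow> S i j ` V \<subseteq> V"
    and disj_V: "\<And>i. i \<in> {1..N} \<Longrightarrow> disjoint_family_on (\<lambda>j. S i j ` V) (J i)"
    and D_pos: "0 < D" and dist_K: "\<And>x y. x \<in> K \<Longrightarrow> y \<in> K \<Longrightarrow> dist x y \<le> D"
    and p_pos: "0 < p" and q_less_1: "q < 1"
    and r_bounds: "\<And>i j. i \<in> {1..N} \<Longrightarrow> j \<in> J i \<Longrightarrow> p \<le> r i j \<and> r i j \<le> q"

locale similarity_rifs_path = similarity_rifs +
  fixes \<omega> :: "nat \<Rightarrow> nat"
  assumes \<omega>: "\<omega> \<in> Omega N"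
begin

definition words :: "nat \<Rightarrow> (nat \<Rightarrow> nat) set" where
  "words n = (\<Pi>\<^sub>E k\<in>{..<n}. J (\<omega> k))"

text \<open>In contrast to membership in the finite set \<open>words n\<close>, this ignores the
  values from \<open>n\<close> on and so passes to prefixes of the same function.\<close>

definition is_word :: "(nat \<Rightarrow> nat) \<Rightarrow> nat \<Rightarrow> bool" where
  "is_word x n \<longleftrightarrow> (\<forall>k<n. x k \<in> J (\<omega> k))"

definition ratio :: "(nat \<Rightarrow> nat) \<Rightarrow> nat \<Rightarrow> real" where
  "ratio x n = (\<Prod>k<n. r (\<omega> k) (x k))"

definition weight :: "(nat \<Rightarrow> nat) \<Rightarrow> nat \<Rightarrow> real" where
  "weight x n = (\<Prod>k<n. r (\<omega> k) (x k) powr s (\<omega> k))"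

abbreviation "W \<equiv> word_map S \<omega>"

abbreviation "F \<equiv> rifs_attractor K J S \<omega>"

lemma index_\<omega>: "\<omega> k \<in> {1..N}"
  using \<omega> by (auto simp: Omega_def)

lemma words_is_word: "x \<in> words n \<Longrightarrow> is_word x n"
  by (auto simp: words_def is_word_def)

lemma finite_words [simp]: "finite (words n)"
  unfolding words_def by (intro finite_PiE finite_J index_\<omega>) auto

lemma is_word_mono: "is_word x n \<Longrightarrow> m \<le> n \<Longrightarrow> is_word x m"
  by (auto simp: is_word_def)

lemma r_word: "is_word x n \<Longrightarrow> k < n \<Longrightarrow> p \<le> r (\<omega> k) (x k) \<and> r (\<omega> k) (x k) \<le> q"
  using r_bounds[OF index_\<omega>] by (auto simp: is_word_def)

lemma ratio_0 [simp]: "ratio x 0 = 1"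
  by (simp add: ratio_def)

lemma ratio_Suc: "ratio x (Suc n) = ratio x n * r (\<omega> n) (x n)"
  by (simp add: ratio_def)

lemma ratio_pos: "is_word x n \<Longrightarrow> 0 < ratio x n"
  unfolding ratio_def using p_pos by (intro prod_pos) (force dest!: r_word)

lemma ratio_le_power: "is_word x n \<Longrightarrow> ratio x n \<le> q ^ n"
  using prod_mono[of "{..<n}" "\<lambda>k. r (\<omega> k) (x k)" "\<lambda>_. q"] r_word[of x n] p_pos
  by (force simp: ratio_def)

lemma ratio_cong: "(\<And>k. k < n \<Longrightarrow> x k = y k) \<Longrightarrow> ratio x n = ratio y n"
  unfolding ratio_def by (intro prod.cong) auto

lemma weight_pos: "is_word x n \<Longrightarrow> 0 < weight x n"
  unfolding weight_def using p_pos by (intro prod_pos) (force dest!: r_word)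

lemma ratio_powr: "ratio x n powr t = (\<Prod>k<n. r (\<omega> k) (x k) powr t)"
  unfolding ratio_def
  by (rule prod_powr_distrib)

lemma ratio_powr_le_weight:
  assumes "is_word x n" "\<And>k. s (\<omega> k) \<le> t"
  shows "ratio x n powr t \<le> weight x n"
  unfolding ratio_powr weight_def
proof (intro prod_mono conjI)
  fix k assume "k \<in> {..<n}"
  then show "r (\<omega> k) (x k) powr t \<le> r (\<omega> k) (x k) powr s (\<omega> k)"
    using r_word[OF assms(1), of k] p_pos q_less_1 assms(2)[of k] by (intro powr_mono') auto
qed auto

lemma weight_le_ratio_powr:
  assumes "is_word x n" "\<And>k. t \<le> s (\<omega> k)"
  shows "weight x n \<le> ratio x n powr t"
  unfolding ratio_powr weight_def
proof (intro prod_mono conjI)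
  fix k assume "k \<in> {..<n}"
  then show "r (\<omega> k) (x k) powr s (\<omega> k) \<le> r (\<omega> k) (x k) powr t"
    using r_word[OF assms(1), of k] p_pos q_less_1 assms(2)[of k] by (intro powr_mono') auto
qed auto

text \<open>The sum over a product of index sets factorises: prescribed positions contribute their
  own factor, and each free position contributes 1 by the equation defining \<open>s\<close>. So the
  weight is additive on cylinders.\<close>

lemma sum_weight_extensions:
  assumes "is_word x m" "m \<le> n"
  shows "(\<Sum>y | y \<in> words n \<and> (\<forall>k<m. y k = x k). weight y n) = weight x m"
proof -
  let ?B = "\<lambda>k. if k < m then {x k} else J (\<omega> k)"
  have "{y \<in> words n. \<forall>k<m. y k = x k} = (\<Pi>\<^sub>E k\<in>{..<n}. ?B k)"
  proof (intro set_eqI iffI)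
    fix y assume y: "y \<in> (\<Pi>\<^sub>E k\<in>{..<n}. ?B k)"
    have "y k = x k" if "k < m" for k
      using PiE_mem[OF y, of k] that assms by simp
    moreover have "y \<in> words n"
      unfolding words_def using y assms by (auto simp: PiE_iff is_word_def split: if_splits) (metis lessThan_iff)
    ultimately show "y \<in> {y \<in> words n. \<forall>k<m. y k = x k}" by auto
  qed (auto simp: words_def PiE_iff)
  then have "(\<Sum>y | y \<in> words n \<and> (\<forall>k<m. y k = x k). weight y n)
      = (\<Prod>k<n. \<Sum>j\<in>?B k. r (\<omega> k) j powr s (\<omega> k))"
    unfolding weight_def using finite_J[OF index_\<omega>] by (subst prod_sum_PiE) auto
  also have "\<dots> = (\<Prod>k<n. if k < m then r (\<omega> k) (x k) powr s (\<omega> k) else 1)"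
    by (intro prod.cong) (simp_all add: sum_r[OF index_\<omega>])
  also have "\<dots> = weight x m"
    unfolding weight_def using assms(2)
    by (subst prod.If_cases) (auto intro!: prod.cong)
  finally show ?thesis .
qed

lemma sum_weight_words: "(\<Sum>y\<in>words n. weight y n) = 1"
  \<comment> \<open>An empty prefix prescribes nothing, so any function can serve as
    \<open>x\<close>.\<close>
  using sum_weight_extensions[of undefined 0 n] by (simp add: is_word_def weight_def)

lemma dist_W: "is_word x n \<Longrightarrow> dist (W x n a) (W x n b) = ratio x n * dist a b"
proof (induction n arbitrary: a b)
  case (Suc n)
  then have "is_word x n" "x n \<in> J (\<omega> n)" by (auto simp: is_word_def)
  then show ?case
    using Suc.IH dist_S[OF index_\<omega>] by (simp add: ratio_Suc)
qed simp

lemma inj_W: "is_word x n \<Longrightarrow> inj (W x n)"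
  using dist_W ratio_pos by (intro injI) (metis dist_eq_0_iff less_numeral_extra(3) mult_eq_0_iff)

lemma W_image_antimono:
  assumes "\<And>i j. i \<in> {1..N} \<Longrightarrow> j \<in> J i \<Longrightarrow> S i j ` A \<subseteq> A"
  shows "is_word x n \<Longrightarrow> m \<le> n \<Longrightarrow> W x n ` A \<subseteq> W x m ` A"
proof (induction n)
  case (Suc n)
  then have "is_word x n" "x n \<in> J (\<omega> n)" by (auto simp: is_word_def)
  show ?case
  proof (cases "m \<le> n")
    case True
    have "W x (Suc n) ` A = W x n ` (S (\<omega> n) (x n) ` A)"
      by (simp add: image_comp)
    also have "\<dots> \<subseteq> W x n ` A"
      using assms[OF index_\<omega> \<open>x n \<in> J (\<omega> n)\<close>] by (rule image_mono)
    finally show ?thesis using Suc.IH[OF \<open>is_word x n\<close> True] by blast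
  next
    case False
    then have "m = Suc n" using Suc.prems by simp
    then show ?thesis by simp
  qed
qed simp

lemma W_K_antimono: "is_word x n \<Longrightarrow> m \<le> n \<Longrightarrow> W x n ` K \<subseteq> W x m ` K"
  using W_image_antimono S_K by blast

lemma W_V_antimono: "is_word x n \<Longrightarrow> m \<le> n \<Longrightarrow> W x n ` V \<subseteq> W x m ` V"
  using W_image_antimono S_V by blast

text \<open>Before the first difference \<open>l\<close> the two words give the same injective map,
  at \<open>l\<close> the open set condition separates the images of \<open>V\<close>, and later
  maps only shrink them.\<close>

lemma W_V_disjoint:
  assumes "is_word x m" "is_word y n" "l < m" "l < n" "x l \<noteq> y l" "\<And>k. k < l \<Longrightarrow> x k = y k"
  shows "W x m ` V \<inter> W y n ` V = {}"
proof -
  have "x l \<in> J (\<omega> l)" "y l \<in> J (\<omega> l)" using assms by (auto simp: is_word_def)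
  then have "S (\<omega> l) (x l) ` V \<inter> S (\<omega> l) (y l) ` V = {}"
    using disj_V[OF index_\<omega>] \<open>x l \<noteq> y l\<close> by (auto simp: disjoint_family_on_def)
  moreover have "inj (W x l)" using is_word_mono[OF assms(1), of l] assms(3) by (intro inj_W) auto
  ultimately have "W x l ` (S (\<omega> l) (x l) ` V) \<inter> W x l ` (S (\<omega> l) (y l) ` V) = {}"
    by (metis image_Int image_empty)
  moreover have "W x l = W y l" using assms(6) by (rule word_map_cong)
  moreover have "W x m ` V \<subseteq> W x (Suc l) ` V" "W y n ` V \<subseteq> W y (Suc l) ` V"
    using W_V_antimono[OF assms(1), of "Suc l"] W_V_antimono[OF assms(2), of "Suc l"] assms(3,4)
    by (simp_all add: Suc_le_eq del: word_map.simps)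
  ultimately show ?thesis by (simp add: image_comp) blast
qed

section \<open>The attractor as a decreasing intersection of compact sets\<close>

definition level :: "nat \<Rightarrow> 'a set" where
  "level n = (\<Union>x\<in>words n. W x n ` K)"

lemma F_eq: "F = (\<Inter>n. level n)"
  unfolding rifs_attractor_def level_def rifs_comps_eq words_def by simp

lemma compact_level: "compact (level n)"
  unfolding level_def
proof (intro compact_UN finite_words compact_continuous_image compact_K)
  fix x assume "x \<in> words n"
  note x = words_is_word[OF this]
  have "(ratio x n)-lipschitz_on K (W x n)" 
    using dist_W[OF x] ratio_pos[OF x] by (intro lipschitz_onI) auto
  then show "continuous_on K (W x n)" by (rule lipschitz_on_continuous_on)
qed

lemma level_antimono:
  assumes "m \<le> n"
  shows "level n \<subseteq> level m"
proof
  fix a assume "a \<in> level n"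
  then obtain x where x: "x \<in> words n" "a \<in> W x n ` K" by (auto simp: level_def)
  then have "a \<in> W x m ` K" using W_K_antimono[OF words_is_word assms] by blast
  moreover have "W x m = W (restrict x {..<m}) m" by (rule word_map_cong) simp
  moreover have "restrict x {..<m} \<in> words m"
    using x(1) assms by (auto simp: words_def PiE_iff)
  ultimately show "a \<in> level m" by (auto simp: level_def)
qed

lemma compact_F: "compact F"
  unfolding F_eq by (intro compact_Inter) (auto simp: compact_level)

lemma bounded_F: "bounded F"
  using compact_F by (rule compact_imp_bounded)

lemma q_pos: "0 < q" and p_less_1: "p < 1"
proof -
  have "J (\<omega> 0) \<noteq> {}" using sum_r[OF index_\<omega>, of 0] by auto
  then obtain j where "j \<in> J (\<omega> 0)" by blast
  from r_bounds[OF index_\<omega> this] show "0 < q" "p < 1" using p_pos q_less_1 by auto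
qed

section \<open>Upper bounds\<close>

lemma W_K_subset_cball:
  assumes "is_word x n" "z \<in> W x n ` K" "ratio x n * D \<le> \<rho>"
  shows "W x n ` K \<subseteq> cball z \<rho>"
proof clarify
  fix b assume "b \<in> K"
  obtain a where a: "a \<in> K" "z = W x n a" using assms(2) by blast
  have "dist z (W x n b) = ratio x n * dist a b" using a dist_W[OF assms(1)] by simp
  also have "\<dots> \<le> ratio x n * D"
    using ratio_pos[OF assms(1)] dist_K[OF a(1) \<open>b \<in> K\<close>] by (intro mult_left_mono) auto
  finally show "W x n b \<in> cball z \<rho>" using assms(3) by simp
qed

text \<open>Cut a word at the first prefix whose cylinder has size at most \<rho>. The preceding
  prefix was still too large, and one more letter shrinks it by a factor of at least
  \<open>p\<close>.\<close>

lemma exists_word_of_size: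
  assumes "z \<in> F" "0 < \<rho>" "\<rho> \<le> D"
  obtains x m where "is_word x m" "z \<in> W x m ` K" "ratio x m * D \<le> \<rho>" "p * \<rho> \<le> ratio x m * D"
proof -
  obtain n where n: "q ^ n < \<rho> / D"
    using real_arch_pow_inv[of "\<rho> / D" q] q_less_1 assms(2) D_pos by auto
  obtain x where x: "x \<in> words n" "z \<in> W x n ` K"
    using assms(1) unfolding F_eq level_def by blast
  note wx = words_is_word[OF x(1)]
  have "ratio x n * D \<le> q ^ n * D"
    using ratio_le_power[OF wx] D_pos by (intro mult_right_mono) auto
  also have "\<dots> \<le> \<rho>" using n D_pos by (simp add: field_simps)
  finally have n_ok: "ratio x n * D \<le> \<rho>" .
  define m where "m = (LEAST m. ratio x m * D \<le> \<rho>)"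
  have m: "ratio x m * D \<le> \<rho>" unfolding m_def by (rule LeastI[of _ n]) (rule n_ok)
  have "m \<le> n" unfolding m_def by (rule Least_le) (rule n_ok)
  have wm: "is_word x m" using is_word_mono[OF wx \<open>m \<le> n\<close>] .
  have "p * \<rho> \<le> ratio x m * D"
  proof (cases m)
    case 0
    \<comment> \<open>No preceding prefix exists here; the assumption \<open>\<rho> \<le> D\<close>
      takes its place.\<close>
    have "p * \<rho> \<le> 1 * D" using p_less_1 p_pos assms by (intro mult_mono) auto
    then show ?thesis using 0 by simp
  next
    case (Suc k)
    then have "\<not> ratio x k * D \<le> \<rho>" unfolding m_def by (metis lessI not_less_Least)
    then have "p * \<rho> \<le> p * (ratio x k * D)" using p_pos by simp
    also have "\<dots> \<le> r (\<omega> k) (x k) * (ratio x k * D)"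
      using r_word[OF wm, of k] ratio_pos[OF is_word_mono[OF wm, of k]] Suc D_pos
      by (intro mult_right_mono) auto
    finally show ?thesis by (simp add: Suc ratio_Suc mult_ac)
  qed
  then show ?thesis
    using that wm m W_K_antimono[OF wx \<open>m \<le> n\<close>] x(2) by blast
qed

text \<open>Each ball contains a cylinder of comparable size, whose weight dominates its term up to
  the factor \<open>(2 * D / p) powr t\<close>. Disjoint balls give disjoint families of words, of
  total weight at most 1.\<close>

lemma packing_sum_le:
  assumes P: "P \<in> packings D F" and Q: "finite Q" "Q \<subseteq> P" and t: "\<And>k. s (\<omega> k) \<le> t" "0 \<le> t"
  shows "(\<Sum>z\<in>Q. (2 * snd z) powr t) \<le> (2 * D / p) powr t"
proof -
  have z: "fst z \<in> F" "0 < snd z" "snd z \<le> D" if "z \<in> Q" for z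
    using that P Q by (auto simp: packings_def)
  then have "\<forall>z\<in>Q. \<exists>x m. is_word x m \<and> fst z \<in> W x m ` K \<and> ratio x m * D \<le> snd z \<and>
      p * snd z \<le> ratio x m * D"
    using exists_word_of_size by metis
  then obtain x m where xm: "\<And>z. z \<in> Q \<Longrightarrow> is_word (x z) (m z)"
    "\<And>z. z \<in> Q \<Longrightarrow> fst z \<in> W (x z) (m z) ` K" "\<And>z. z \<in> Q \<Longrightarrow> ratio (x z) (m z) * D \<le> snd z"
    "\<And>z. z \<in> Q \<Longrightarrow> p * snd z \<le> ratio (x z) (m z) * D"
    by metis
  \<comment> \<open>Cylinders of different lengths are compared by splitting each into its
    extensions of one common length \<open>n\<close>.\<close>
  define n where "n = Max (insert 0 (m ` Q))"
  have n: "m z \<le> n" if "z \<in> Q" for z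
    unfolding n_def using that Q by (intro Max_ge) auto
  define X where "X z = {y. y \<in> words n \<and> (\<forall>k<m z. y k = x z k)}" for z
  \<comment> \<open>The image of one fixed point under a word of length \<open>n\<close> shows which
    ball the word belongs to, so a word cannot lie in two of the sets \<open>X z\<close>.\<close>
  obtain x0 where x0: "x0 \<in> K" using V_ne V_K by blast
  have in_ball: "W y n x0 \<in> cball (fst z) (snd z)" if "z \<in> Q" "y \<in> X z" for y z
  proof -
    have y: "is_word y n" using that words_is_word by (auto simp: X_def)
    have "W y n x0 \<in> W y (m z) ` K"
      using W_K_antimono[OF y n[OF that(1)]] x0 by blast
    also have "W y (m z) = W (x z) (m z)"
      using that(2) by (intro word_map_cong) (auto simp: X_def)
    also have "W (x z) (m z) ` K \<subseteq> cball (fst z) (snd z)"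
      using that xm by (intro W_K_subset_cball) auto
    finally show ?thesis .
  qed
  have disj: "X z \<inter> X z' = {}" if "z \<in> Q" "z' \<in> Q" "z \<noteq> z'" for z z'
  proof -
    have "cball (fst z) (snd z) \<inter> cball (fst z') (snd z') = {}"
      using P Q that unfolding packings_def pairwise_def by blast
    then show ?thesis using in_ball that by blast
  qed
  have "(\<Sum>z\<in>Q. (2 * snd z) powr t) \<le> (\<Sum>z\<in>Q. (2 * D / p) powr t * weight (x z) (m z))"
  proof (rule sum_mono)
    fix z assume "z \<in> Q"
    have "(2 * snd z) powr t \<le> (2 * D / p * ratio (x z) (m z)) powr t"
      using xm(4)[OF \<open>z \<in> Q\<close>] z[OF \<open>z \<in> Q\<close>] p_pos t by (intro powr_mono2) (auto simp: field_simps)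
    also have "\<dots> = (2 * D / p) powr t * ratio (x z) (m z) powr t"
      by (rule powr_mult)
    also have "\<dots> \<le> (2 * D / p) powr t * weight (x z) (m z)"
      using ratio_powr_le_weight[OF xm(1)[OF \<open>z \<in> Q\<close>] t(1)] by (intro mult_left_mono) auto
    finally show "(2 * snd z) powr t \<le> (2 * D / p) powr t * weight (x z) (m z)" .
  qed
  also have "\<dots> = (2 * D / p) powr t * (\<Sum>z\<in>Q. \<Sum>y\<in>X z. weight y n)"
    using sum_weight_extensions xm(1) n by (simp add: X_def sum_distrib_left)
  also have "(\<Sum>z\<in>Q. \<Sum>y\<in>X z. weight y n) = (\<Sum>y\<in>(\<Union>z\<in>Q. X z). weight y n)"
    using Q disj by (intro sum.UNION_disjoint[symmetric]) (auto simp: X_def)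
  also have "\<dots> \<le> (\<Sum>y\<in>words n. weight y n)"
    using weight_pos words_is_word by (intro sum_mono2) (auto simp: X_def less_imp_le)
  finally show ?thesis
    by (simp add: sum_weight_words mult_left_mono)
qed

lemma packing_infsum_le:
  assumes P: "P \<in> packings D F" and t: "\<And>k. s (\<omega> k) \<le> t" "0 \<le> t"
  shows "(\<Sum>\<^sub>\<infinity>z\<in>P. ennreal ((2 * snd z) powr t)) \<le> ennreal ((2 * D / p) powr t)"
proof (rule infsum_ennreal_leI)
  fix Q assume "finite Q" "Q \<subseteq> P"
  from packing_sum_le[OF P this t]
  show "(\<Sum>z\<in>Q. ennreal ((2 * snd z) powr t)) \<le> ennreal ((2 * D / p) powr t)"
    by (simp add: ennreal_leI)
qed

lemma packing_pre_F_le: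
  assumes t: "\<And>k. s (\<omega> k) \<le> t" "0 \<le> t"
  shows "packing_pre t F \<le> ennreal ((2 * D / p) powr t)"
proof -
  have "packing_pre t F \<le> (SUP P \<in> packings D F. (\<Sum>\<^sub>\<infinity>p\<in>P. ennreal ((2 * snd p) powr t)))"
    unfolding packing_pre_def by (rule INF_lower) (use D_pos in auto)
  also have "\<dots> \<le> ennreal ((2 * D / p) powr t)"
    by (intro SUP_least packing_infsum_le t)
  finally show ?thesis .
qed

lemma packing_pre_F_eq_0:
  assumes "\<And>k. s (\<omega> k) \<le> t" "0 \<le> t" "t < u"
  shows "packing_pre u F = 0"
  using packing_infsum_le[OF _ assms(1,2)] D_pos assms(3) by (rule packing_pre_eq_0)

section \<open>Lower bounds\<close>

text \<open>Cut each word where its ratio first drops to \<rho>. Different cut words carry disjoint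
  balls of radius \<open>p * \<rho> * a\<close> inside a ball of radius
  \<open>\<rho> * (1 + D + a)\<close>, so volume bounds their number, and each carries weight at
  most \<open>\<rho> powr t\<close>.\<close>

lemma sum_weight_ball_le:
  assumes t: "\<And>k. t \<le> s (\<omega> k)" "0 \<le> t" and a: "ball x0 a \<subseteq> V" "0 < a"
    and \<rho>: "0 < \<rho>" "q ^ n \<le> \<rho>"
  shows "(\<Sum>y | y \<in> words n \<and> W y n x0 \<in> ball u \<rho>. weight y n)
    \<le> ((1 + D + a) / (p * a)) ^ DIM('a) * \<rho> powr t"
proof -
  define B where "B = {y. y \<in> words n \<and> W y n x0 \<in> ball u \<rho>}"
  let ?M = "((1 + D + a) / (p * a)) ^ DIM('a)"
  have finB: "finite B" by (simp add: B_def)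
  have x0: "x0 \<in> V" "x0 \<in> K" using a V_K centre_in_ball by blast+
  show ?thesis
  proof (cases "1 \<le> \<rho>")
    \<comment> \<open>The total weight 1 already suffices here. In the other case the empty prefix
      has ratio above \<rho>, so every cut length is positive.\<close>
    case True
    have "p * a \<le> 1 * a" using p_less_1 a by (intro mult_right_mono) auto
    then have "p * a \<le> 1 + D + a" using D_pos by simp
    then have "1 \<le> (1 + D + a) / (p * a)" using p_pos a by simp
    then have "1 * 1 \<le> ?M * \<rho> powr t"
      using True t by (intro mult_mono one_le_power ge_one_powr_ge_zero) auto
    moreover have "(\<Sum>y\<in>B. weight y n) \<le> (\<Sum>y\<in>words n. weight y n)"
      using weight_pos words_is_word by (intro sum_mono2) (auto simp: B_def less_imp_le)
    ultimately show ?thesis by (simp add: sum_weight_words B_def)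
  next
    case False
    define m where "m y = (LEAST m. ratio y m \<le> \<rho>)" for y
    \<comment> \<open>The cut word as a canonical object: its length and the function restricted
      below that length.\<close>
    define g where "g y = (m y, restrict y {..<m y})" for y
    have m: "m y \<le> n" "ratio y (m y) \<le> \<rho>" "p * \<rho> \<le> ratio y (m y)" "is_word y (m y)" "is_word y n"
      if "y \<in> B" for y
    proof -
      show y: "is_word y n" using that words_is_word by (simp add: B_def)
      have n_ok: "ratio y n \<le> \<rho>" using ratio_le_power[OF y] \<rho> by linarith
      show le: "ratio y (m y) \<le> \<rho>" unfolding m_def by (rule LeastI[of _ n]) (rule n_ok)
      show "m y \<le> n" unfolding m_def by (rule Least_le) (rule n_ok)
      then show wm: "is_word y (m y)" by (rule is_word_mono[OF y])
      obtain k where k: "m y = Suc k" using le False by (cases "m y") auto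
      then have "\<not> ratio y k \<le> \<rho>" unfolding m_def by (metis lessI not_less_Least)
      then have "p * \<rho> \<le> p * ratio y k" using p_pos by simp
      also have "\<dots> \<le> r (\<omega> k) (y k) * ratio y k"
        using r_word[OF wm, of k] ratio_pos[OF is_word_mono[OF wm, of k]] k
        by (intro mult_right_mono) auto
      finally show "p * \<rho> \<le> ratio y (m y)" by (simp add: k ratio_Suc mult_ac)
    qed
    define c where "c b = W (snd b) (fst b) x0" for b
    have c: "c (g y) = W y (m y) x0" for y
      unfolding c_def g_def using word_map_cong[of "m y" "restrict y {..<m y}" y S \<omega>] by simp
    have ball_c: "ball (c (g y)) (p * \<rho> * a) \<subseteq> W y (m y) ` V" if "y \<in> B" for y
    proof -
      have "p * \<rho> * a \<le> ratio y (m y) * a" using m(3)[OF that] a by (intro mult_right_mono) auto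
      then have "ball (c (g y)) (p * \<rho> * a) \<subseteq> ball (W y (m y) x0) (ratio y (m y) * a)"
        unfolding c by (rule subset_ball)
      also have "\<dots> = W y (m y) ` ball x0 a"
        using dist_W ratio_pos m(4)[OF that] by (intro similarity_image_ball[symmetric]) auto
      also have "\<dots> \<subseteq> W y (m y) ` V" using a by (intro image_mono)
      finally show ?thesis .
    qed
    \<comment> \<open>By minimality of the cut, no cut word is a proper prefix of another. Distinct
      ones therefore differ below both lengths, and the first difference is what
      \<open>W_V_disjoint\<close> asks for.\<close>
    have differ: "\<exists>l. l < m y \<and> l < m y' \<and> y l \<noteq> y' l \<and> (\<forall>k<l. y k = y' k)"
      if "y \<in> B" "y' \<in> B" "g y \<noteq> g y'" for y y'
    proof -
      have *: "g x = g x'" if "x \<in> B" "x' \<in> B" "m x \<le> m x'" "\<forall>l<m x. x l = x' l" for x x'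
      proof -
        have "ratio x' (m x) = ratio x (m x)" using that(4) by (intro ratio_cong) auto
        then have "ratio x' (m x) \<le> \<rho>" using m(2)[OF that(1)] by simp
        then have "m x' \<le> m x" unfolding m_def[of x'] by (rule Least_le)
        then have "m x = m x'" using that(3) by simp
        then show ?thesis using that(4) by (auto simp: g_def restrict_def fun_eq_iff)
      qed
      have "\<exists>l. l < m y \<and> l < m y' \<and> y l \<noteq> y' l"
      proof (rule ccontr)
        assume no: "\<not> ?thesis"
        show False
        proof (cases "m y \<le> m y'")
          case True
          then have "\<forall>l<m y. y l = y' l" using no by auto
          with * that True show False by blast
        next
          case False
          then have "\<forall>l<m y'. y' l = y l" using no by (metis less_trans not_le)
          with *[of y' y] that False show False by auto
        qed
      qed
      then have "\<exists>l. y l \<noteq> y' l" by blast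
      define l where "l = (LEAST l. y l \<noteq> y' l)"
      have "y l \<noteq> y' l" unfolding l_def using \<open>\<exists>l. y l \<noteq> y' l\<close> by (rule LeastI_ex)
      moreover have "\<forall>k<l. y k = y' k" unfolding l_def using not_less_Least by blast
      moreover obtain l' where "l' < m y" "l' < m y'" "y l' \<noteq> y' l'"
        using \<open>\<exists>l. l < m y \<and> l < m y' \<and> y l \<noteq> y' l\<close> by blast
      moreover have "l \<le> l'" unfolding l_def by (rule Least_le) fact
      ultimately show ?thesis by (intro exI[of _ l]) auto
    qed
    have "real (card (g ` B)) * (p * \<rho> * a) ^ DIM('a) \<le> (\<rho> * (1 + D + a)) ^ DIM('a)"
    proof (rule card_disjoint_balls_le)
      show "disjoint_family_on (\<lambda>b. ball (c b) (p * \<rho> * a)) (g ` B)"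
        unfolding disjoint_family_on_def
      proof (intro ballI impI)
        fix b b' assume "b \<in> g ` B" "b' \<in> g ` B" "b \<noteq> b'"
        then obtain y y' where y: "y \<in> B" "y' \<in> B" "g y \<noteq> g y'" and b: "b = g y" "b' = g y'"
          by blast
        obtain l where "l < m y" "l < m y'" "y l \<noteq> y' l" "\<forall>k<l. y k = y' k"
          using differ[OF y] by blast
        then have "W y (m y) ` V \<inter> W y' (m y') ` V = {}"
          using m(4) y by (intro W_V_disjoint) auto
        then show "ball (c b) (p * \<rho> * a) \<inter> ball (c b') (p * \<rho> * a) = {}"
          unfolding b using ball_c[OF y(1)] ball_c[OF y(2)] by blast
      qed
    next
      fix b assume "b \<in> g ` B"
      then obtain y where y: "y \<in> B" "b = g y" by blast
      \<comment> \<open>The three parts of the outer radius: \<open>\<rho> * D\<close> from the ball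
        centre to the point of the full word, \<rho> from there to \<open>u\<close>, and at most
        \<open>\<rho> * a\<close> for the small ball.\<close>
      obtain x1 where "x1 \<in> K" "W y n x0 = W y (m y) x1"
        using W_K_antimono[OF m(5,1)[OF y(1)]] x0 by blast
      then have "dist (W y (m y) x0) (W y n x0) \<le> ratio y (m y) * D"
        using dist_W[OF m(4)[OF y(1)]] dist_K[OF x0(2)] ratio_pos[OF m(4)[OF y(1)]] by simp
      also have "\<dots> \<le> \<rho> * D" using m(2)[OF y(1)] D_pos by simp
      finally have "dist (c b) (W y n x0) \<le> \<rho> * D" by (simp add: y c)
      moreover have "dist (W y n x0) u < \<rho>" using y(1) by (simp add: B_def dist_commute)
      ultimately have "dist (c b) u < \<rho> * D + \<rho>"
        using dist_triangle[of "c b" u "W y n x0"] by linarith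
      moreover have "p * \<rho> * a \<le> \<rho> * a" using p_less_1 \<rho> a by simp
      ultimately have "dist (c b) u + p * \<rho> * a \<le> \<rho> * (1 + D + a)" by (simp add: algebra_simps)
      then show "ball (c b) (p * \<rho> * a) \<subseteq> ball u (\<rho> * (1 + D + a))"
        by (simp add: ball_subset_ball_iff)
    qed (use finB \<rho> a p_pos D_pos in auto)
    then have "real (card (g ` B)) \<le> (\<rho> * (1 + D + a)) ^ DIM('a) / (p * \<rho> * a) ^ DIM('a)"
      using \<rho> a p_pos by (subst pos_le_divide_eq) auto
    also have "\<dots> = (\<rho> * (1 + D + a) / (p * \<rho> * a)) ^ DIM('a)" by (rule power_divide[symmetric])
    also have "\<rho> * (1 + D + a) / (p * \<rho> * a) = (1 + D + a) / (p * a)" using \<rho> by simp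
    finally have card: "real (card (g ` B)) \<le> ?M" .
    have "(\<Sum>y\<in>B. weight y n) = (\<Sum>b\<in>g ` B. \<Sum>y | y \<in> B \<and> g y = b. weight y n)"
      by (rule sum.image_gen[OF finB])
    also have "\<dots> \<le> (\<Sum>b\<in>g ` B. \<rho> powr t)"
    proof (rule sum_mono)
      fix b assume "b \<in> g ` B"
      then obtain y0 where y0: "y0 \<in> B" "b = g y0" by blast
      \<comment> \<open>Words with the same cut lie in one cylinder, whose weight bounds the
        group.\<close>
      have "{y. y \<in> B \<and> g y = b} \<subseteq> {y. y \<in> words n \<and> (\<forall>k<m y0. y k = y0 k)}"
      proof (intro subsetI CollectI conjI allI impI)
        fix y assume "y \<in> {y. y \<in> B \<and> g y = b}"
        then have y: "y \<in> B" "m y = m y0" "restrict y {..<m y0} = restrict y0 {..<m y0}"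
          by (auto simp: g_def y0(2))
        show "y \<in> words n" using y(1) by (simp add: B_def)
        fix k assume "k < m y0"
        then show "y k = y0 k" using fun_cong[OF y(3), of k] by simp
      qed
      then have "(\<Sum>y | y \<in> B \<and> g y = b. weight y n)
          \<le> (\<Sum>y | y \<in> words n \<and> (\<forall>k<m y0. y k = y0 k). weight y n)"
        using weight_pos words_is_word by (intro sum_mono2) (auto simp: less_imp_le)
      also have "\<dots> = weight y0 (m y0)" using m y0 by (intro sum_weight_extensions) auto
      also have "\<dots> \<le> ratio y0 (m y0) powr t" using m y0 t by (intro weight_le_ratio_powr) auto
      also have "\<dots> \<le> \<rho> powr t"
        using m(2,4)[OF y0(1)] ratio_pos t by (intro powr_mono2) (auto simp: less_imp_le)
      finally show "(\<Sum>y | y \<in> B \<and> g y = b. weight y n) \<le> \<rho> powr t" .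
    qed
    also have "\<dots> \<le> ?M * \<rho> powr t" using card by (simp add: mult_right_mono)
    finally show ?thesis by (simp add: B_def)
  qed
qed

end

text \<open>The mass estimate concerns open balls of positive radius, while a covering set may have
  diameter 0. The slack \<open>e\<close> pays for enlarging it.\<close>

lemma bounded_subset_ball_powr_le:
  fixes U :: "'b::metric_space set"
  assumes "bounded U" "u \<in> U" "0 \<le> t" "0 < e"
  shows "\<exists>\<rho>>0. U \<subseteq> ball u \<rho> \<and> \<rho> powr t \<le> 2 powr t * diam_pow t U + e"
proof (cases "t = 0")
  case True
  have "U \<subseteq> ball u (diameter U + 1)"
    using diameter_bounded_bound[OF assms(1,2)] by force
  moreover have "0 < diameter U + 1" using diameter_ge_0[OF assms(1)] by linarith
  ultimately show ?thesis
    using True assms by (intro exI[of _ "diameter U + 1"]) (auto simp: diam_pow_def)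
next
  case False
  then have t: "0 < t" using assms by simp
  \<comment> \<open>The first entry exceeds the diameter when that is positive; the second keeps the
    radius positive and contributes exactly \<open>e\<close> to the power.\<close>
  define \<rho> where "\<rho> = max (2 * diameter U) (e powr (1 / t))"
  have d: "0 \<le> diameter U" using diameter_ge_0[OF assms(1)] .
  have \<rho>: "diameter U < \<rho>"
    using d assms(4) by (cases "diameter U = 0") (auto simp: \<rho>_def less_max_iff_disj)
  have "\<rho> powr t \<le> (2 * diameter U) powr t + (e powr (1 / t)) powr t"
    unfolding \<rho>_def max_def by auto
  also have "\<dots> = 2 powr t * diam_pow t U + e"
    using t d assms by (auto simp: diam_pow_def powr_mult powr_powr)
  finally show ?thesis
    using \<rho> d diameter_bounded_bound[OF assms(1,2)] by (intro exI[of _ \<rho>]) force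
qed

section \<open>Mass distribution and covers of the attractor\<close>

context similarity_rifs_path
begin

text \<open>Otherwise the sets \<open>level n - G\<close> would be nonempty, compact and decreasing,
  and would have a common point, lying in \<open>F\<close> but not in \<open>G\<close>.\<close>

lemma level_subset_open:
  assumes "open G" "F \<subseteq> G"
  obtains n where "level n \<subseteq> G"
proof (rule ccontr)
  assume *: "\<not> thesis"
  have "\<Inter>(range (\<lambda>n. level n - G)) \<noteq> {}"
  proof (rule compact_nest)
    show "level n - G \<noteq> {}" for n using * that by blast
    show "compact (level n - G)" for n using compact_level assms(1) by (rule compact_diff)
    show "level n - G \<subseteq> level m - G" if "m \<le> n" for m n using level_antimono[OF that] by blast
  qed
  then show False using assms(2) unfolding F_eq by blast
qed

text \<open>Mass distribution: a cover is enlarged to finitely many balls, which then also cover all the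
  points \<open>W x n x0\<close> for some large \<open>n\<close>, and these carry total weight 1.\<close>

lemma cover_sum_ge:
  assumes t: "\<And>k. t \<le> s (\<omega> k)" "0 \<le> t" and a: "ball x0 a \<subseteq> V" "0 < a"
    and U: "F \<subseteq> (\<Union>k. U k)" "\<And>k::nat. bounded (U k)"
  shows "ennreal (1 / (2 * ((1 + D + a) / (p * a)) ^ DIM('a) * 2 powr t))
    \<le> (\<Sum>k. ennreal (diam_pow t (U k)))"
proof (cases "(\<Sum>k. ennreal (diam_pow t (U k)))")
  case (real \<sigma>)
  define M where "M = ((1 + D + a) / (p * a)) ^ DIM('a)"
  have M: "0 < M" using D_pos p_pos a by (simp add: M_def)
  have x0: "x0 \<in> K" using a V_K centre_in_ball by blast
  have partial: "(\<Sum>k\<in>I. diam_pow t (U k)) \<le> \<sigma>" if "finite I" for I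
  proof -
    have "ennreal (\<Sum>k\<in>I. diam_pow t (U k)) = (\<Sum>k\<in>I. ennreal (diam_pow t (U k)))"
      by (rule sum_ennreal[symmetric]) (rule diam_pow_nonneg)
    also have "\<dots> \<le> ennreal \<sigma>"
      unfolding real(2)[symmetric] using that by (intro sum_le_suminf) auto
    finally show ?thesis using real(1) by simp
  qed
  \<comment> \<open>The errors, weighted by powers of 1/2, cost at most \<open>2 * M * e\<close>,
    which is half of the unit mass.\<close>
  define e where "e = 1 / (4 * M)"
  have e: "0 < e" using M by (simp add: e_def)
  \<comment> \<open>Empty covering sets are dropped, as they offer no centre for a ball.\<close>
  define I where "I = {k. U k \<noteq> {}}"
  define u where "u k = (SOME z. z \<in> U k)" for k
  have u: "u k \<in> U k" if "k \<in> I" for k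
    using that unfolding u_def I_def by (auto intro: someI)
  have "\<forall>k\<in>I. \<exists>\<rho>>0. U k \<subseteq> ball (u k) \<rho> \<and> \<rho> powr t \<le> 2 powr t * diam_pow t (U k) + e * (1/2) ^ k"
    using e U(2) t u by (intro ballI bounded_subset_ball_powr_le) auto
  then obtain \<rho> where \<rho>: "\<And>k. k \<in> I \<Longrightarrow> 0 < \<rho> k" "\<And>k. k \<in> I \<Longrightarrow> U k \<subseteq> ball (u k) (\<rho> k)"
    "\<And>k. k \<in> I \<Longrightarrow> \<rho> k powr t \<le> 2 powr t * diam_pow t (U k) + e * (1/2) ^ k"
    by metis
  have "F \<subseteq> (\<Union>k\<in>I. ball (u k) (\<rho> k))"
  proof
    fix z assume "z \<in> F"
    then obtain k where "z \<in> U k" using U by blast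
    then have "k \<in> I" by (auto simp: I_def)
    with \<open>z \<in> U k\<close> \<rho>(2) show "z \<in> (\<Union>k\<in>I. ball (u k) (\<rho> k))" by blast
  qed
  then obtain I' where I': "I' \<subseteq> I" "finite I'" "F \<subseteq> (\<Union>k\<in>I'. ball (u k) (\<rho> k))"
    using compactE_image[OF compact_F, of I "\<lambda>k. ball (u k) (\<rho> k)"] by auto
  have "open (\<Union>k\<in>I'. ball (u k) (\<rho> k))" by blast
  then obtain n0 where n0: "level n0 \<subseteq> (\<Union>k\<in>I'. ball (u k) (\<rho> k))"
    using level_subset_open[OF _ I'(3)] by blast
  have "\<forall>\<^sub>F n in sequentially. q ^ n \<le> \<rho> k" if "k \<in> I'" for k
  proof -
    have "(\<lambda>n. q ^ n) \<longlonglongrightarrow> 0" using q_pos q_less_1 by (intro LIMSEQ_realpow_zero) auto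
    then have "\<forall>\<^sub>F n in sequentially. q ^ n < \<rho> k" using \<rho>(1) I' that by (intro order_tendstoD) auto
    then show ?thesis by eventually_elim simp
  qed
  then have "\<forall>\<^sub>F n in sequentially. \<forall>k\<in>I'. q ^ n \<le> \<rho> k"
    using I'(2) by (simp add: eventually_ball_finite_distrib)
  then have "\<forall>\<^sub>F n in sequentially. n0 \<le> n \<and> (\<forall>k\<in>I'. q ^ n \<le> \<rho> k)"
    using eventually_ge_at_top[of n0] by eventually_elim simp
  then obtain n where n: "n0 \<le> n" "\<And>k. k \<in> I' \<Longrightarrow> q ^ n \<le> \<rho> k"
    unfolding eventually_sequentially by blast
  have "1 = (\<Sum>y\<in>words n. weight y n)" by (simp add: sum_weight_words)
  also have "\<dots> \<le> (\<Sum>y\<in>words n. \<Sum>k\<in>I'. if W y n x0 \<in> ball (u k) (\<rho> k) then weight y n else 0)"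
  proof (rule sum_mono)
    fix y assume y: "y \<in> words n"
    then have "W y n x0 \<in> level n" using x0 by (auto simp: level_def)
    then obtain k where k: "k \<in> I'" "W y n x0 \<in> ball (u k) (\<rho> k)"
      using level_antimono[OF n(1)] n0 by blast
    have "weight y n = (if W y n x0 \<in> ball (u k) (\<rho> k) then weight y n else 0)" using k by simp
    also have "\<dots> \<le> (\<Sum>k\<in>I'. if W y n x0 \<in> ball (u k) (\<rho> k) then weight y n else 0)"
      using k I'(2) weight_pos[OF words_is_word[OF y]] by (intro member_le_sum) auto
    finally show "weight y n \<le> (\<Sum>k\<in>I'. if W y n x0 \<in> ball (u k) (\<rho> k) then weight y n else 0)" .
  qed
  also have "\<dots> = (\<Sum>k\<in>I'. \<Sum>y | y \<in> words n \<and> W y n x0 \<in> ball (u k) (\<rho> k). weight y n)"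
    by (subst sum.swap) (simp add: sum.inter_filter[symmetric] del: mem_ball)
  also have "\<dots> \<le> (\<Sum>k\<in>I'. M * \<rho> k powr t)"
    unfolding M_def using I' \<rho>(1) n(2) t a by (intro sum_mono sum_weight_ball_le) auto
  also have "\<dots> \<le> (\<Sum>k\<in>I'. M * (2 powr t * diam_pow t (U k) + e * (1/2) ^ k))"
    using I' \<rho>(3) M by (intro sum_mono mult_left_mono) auto
  also have "\<dots> = M * (2 powr t * (\<Sum>k\<in>I'. diam_pow t (U k)) + e * (\<Sum>k\<in>I'. (1/2) ^ k))"
    by (simp only: sum_distrib_left[symmetric] sum.distrib)
  also have "\<dots> \<le> M * (2 powr t * \<sigma> + e * 2)"
  proof -
    have "(\<Sum>k\<in>I'. (1/2::real) ^ k) \<le> (\<Sum>k. (1/2) ^ k)"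
      using I'(2) by (intro sum_le_suminf) auto
    also have "\<dots> = 2" by (simp add: suminf_geometric)
    finally show ?thesis
      using M e partial[OF I'(2)] by (intro mult_left_mono add_mono) auto
  qed
  also have "\<dots> = M * 2 powr t * \<sigma> + 1 / 2" using M by (simp add: e_def field_simps)
  finally have "1 / (2 * M * 2 powr t) \<le> \<sigma>" using M by (simp add: field_simps)
  then show ?thesis unfolding real(2) M_def by (rule ennreal_leI)
qed simp

text \<open>The mass argument puts no limit on the diameters in the cover, so the bound is the same
  for every \<delta>. This also makes it usable for covering numbers at every scale.\<close>

lemma hausdorff_pre_F_ge:
  assumes "\<And>k. t \<le> s (\<omega> k)" "0 \<le> t" "ball x0 a \<subseteq> V" "0 < a"
  shows "ennreal (1 / (2 * ((1 + D + a) / (p * a)) ^ DIM('a) * 2 powr t)) \<le> hausdorff_pre t \<delta> F"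
  unfolding hausdorff_pre_def using assms by (intro INF_greatest cover_sum_ge) auto

end

section \<open>The dimension formulas\<close>

context similarity_rifs
begin

lemma packing_measure_bounded:
  assumes "\<And>i. i \<in> {1..N} \<Longrightarrow> s i \<le> t" "0 \<le> t"
  shows "(SUP \<omega>\<in>Omega N. packing_measure t (rifs_attractor K J S \<omega>)) < \<infinity>"
proof -
  have "packing_measure t (rifs_attractor K J S \<omega>) \<le> ennreal ((2 * D / p) powr t)" if "\<omega> \<in> Omega N" for \<omega>
  proof -
    interpret similarity_rifs_path K N J S r s V D p q \<omega> by unfold_locales (rule that)
    show ?thesis
      using packing_pre_F_le[of t] assms index_\<omega> by (intro order_trans[OF packing_measure_le_pre]) blast
  qed
  then have "(SUP \<omega>\<in>Omega N. packing_measure t (rifs_attractor K J S \<omega>)) \<le> ennreal ((2 * D / p) powr t)"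
    by (rule SUP_least)
  also have "\<dots> < \<infinity>" by simp
  finally show ?thesis .
qed

lemma hausdorff_measure_bounded_below:
  assumes "\<And>i. i \<in> {1..N} \<Longrightarrow> t \<le> s i" "0 \<le> t"
  shows "0 < (INF \<omega>\<in>Omega N. hausdorff_measure t (rifs_attractor K J S \<omega>))"
proof -
  obtain x0 a where a: "ball x0 a \<subseteq> V" "0 < a"
    using open_V V_ne open_contains_ball by (metis all_not_in_conv)
  have "ennreal (1 / (2 * ((1 + D + a) / (p * a)) ^ DIM('a) * 2 powr t))
      \<le> hausdorff_measure t (rifs_attractor K J S \<omega>)" if "\<omega> \<in> Omega N" for \<omega>
  proof -
    interpret similarity_rifs_path K N J S r s V D p q \<omega> by unfold_locales (rule that)
    show ?thesis
      using hausdorff_pre_F_ge[of t x0 a 1] assms a index_\<omega>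
      by (intro order_trans[OF _ hausdorff_pre_le_measure[of 1]]) auto
  qed
  then have "ennreal (1 / (2 * ((1 + D + a) / (p * a)) ^ DIM('a) * 2 powr t))
      \<le> (INF \<omega>\<in>Omega N. hausdorff_measure t (rifs_attractor K J S \<omega>))"
    by (rule INF_greatest)
  moreover have "0 < ennreal (1 / (2 * ((1 + D + a) / (p * a)) ^ DIM('a) * 2 powr t))"
    using D_pos p_pos a by simp
  ultimately show ?thesis by (rule less_le_trans[rotated])
qed

end

section \<open>Measures and dimensions for a single sequence\<close>

context similarity_rifs_path
begin

lemma hausdorff_pre_F_bounded_below:
  assumes "\<And>k. t \<le> s (\<omega> k)" "0 \<le> t"
  obtains c where "0 < c" "\<And>\<delta>. ennreal c \<le> hausdorff_pre t \<delta> F"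
proof -
  obtain x0 a where a: "ball x0 a \<subseteq> V" "0 < a"
    using open_V V_ne open_contains_ball by (metis all_not_in_conv)
  show ?thesis
    using that[OF _ hausdorff_pre_F_ge[OF assms a]] D_pos p_pos a by simp
qed

lemma hausdorff_measure_F_pos:
  assumes "\<And>k. t \<le> s (\<omega> k)" "0 \<le> t"
  shows "0 < hausdorff_measure t F"
proof -
  obtain c where c: "0 < c" "\<And>\<delta>. ennreal c \<le> hausdorff_pre t \<delta> F"
    using hausdorff_pre_F_bounded_below[OF assms] by blast
  have "ennreal c \<le> hausdorff_measure t F"
    using c(2)[of 1] hausdorff_pre_le_measure[of 1 t F] by simp
  with c(1) show ?thesis by (metis ennreal_less_zero_iff less_le_trans)
qed

lemma packing_measure_F_pos:
  assumes "\<And>k. t \<le> s (\<omega> k)" "0 \<le> t"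
  shows "0 < packing_measure t F"
proof (rule ccontr)
  assume "\<not> 0 < packing_measure t F"
  then have 0: "hausdorff_pre t 1 F \<le> 0"
    using hausdorff_pre_le_packing_measure[OF bounded_F _ assms(2), of 1] by simp
  obtain c where c: "0 < c" "\<And>\<delta>. ennreal c \<le> hausdorff_pre t \<delta> F"
    using hausdorff_pre_F_bounded_below[OF assms] by blast
  from c(2)[of 1] 0 have "ennreal c \<le> 0" by (rule order_trans)
  with c(1) show False by simp
qed

lemma lower_box_dim_F_ge:
  assumes "\<And>k. t \<le> s (\<omega> k)" "0 \<le> t"
  shows "ereal t \<le> lower_box_dim F"
proof -
  obtain c where c: "0 < c" "\<And>\<delta>. ennreal c \<le> hausdorff_pre t \<delta> F"
    using hausdorff_pre_F_bounded_below[OF assms] by blast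
  show ?thesis
    using cover_number_lower[OF bounded_F c(2) _ assms(2)] c(1) by (rule lower_box_dim_ge)
qed

lemma F_nonempty: "F \<noteq> {}"
proof
  assume F: "F = {}"
  obtain n where n: "level n \<subseteq> {}"
    using level_subset_open[of "{}"] F by auto
  have "words n \<noteq> {}"
    using sum_weight_words[of n] by auto
  then show False using n V_ne V_K unfolding level_def by blast
qed

lemma cover_number_F_pos:
  assumes "0 < \<delta>"
  shows "0 < cover_number \<delta> F"
proof (rule ccontr)
  assume "\<not> 0 < cover_number \<delta> F"
  with F_nonempty show False
    by (auto intro: cover_number_cover[OF bounded_F assms])
qed

lemma upper_box_dim_F_le:
  assumes "\<And>k. s (\<omega> k) \<le> t" "0 \<le> t"
  shows "upper_box_dim F \<le> ereal t"
proof (rule upper_box_dim_le)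
  show "real (cover_number \<delta> F) * (\<delta> / 2) powr t \<le> (2 * D / p) powr t" if "0 < \<delta>" "\<delta> \<le> D" for \<delta>
    using bounded_F packing_infsum_le[OF _ assms] that by (rule cover_number_upper) auto
qed (use cover_number_F_pos D_pos in auto)

lemma packing_dim_F_le:
  assumes "\<And>k. s (\<omega> k) \<le> t" "0 \<le> t"
  shows "packing_dim F \<le> ereal t"
proof (rule ereal_le_epsilon2)
  fix e :: real assume "0 < e"
  then have "packing_pre (t + e) F = 0"
    using assms by (intro packing_pre_F_eq_0) auto
  then have "packing_measure (t + e) F = 0"
    using packing_measure_le_pre[of "t + e" F] by simp
  then show "packing_dim F \<le> ereal t + ereal e"
    unfolding packing_dim_def using assms(2) \<open>0 < e\<close> by (intro Inf_lower) auto
qed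

lemma hausdorff_dim_F_le:
  assumes "\<And>k. s (\<omega> k) \<le> t" "0 \<le> t"
  shows "hausdorff_dim F \<le> ereal t"
proof (rule ereal_le_epsilon2)
  fix e :: real assume "0 < e"
  then have "packing_pre (t + e) F = 0"
    using assms by (intro packing_pre_F_eq_0) auto
  then have "hausdorff_measure (t + e) F = 0"
    using hausdorff_measure_le_packing_pre[OF bounded_F, of "t + e"] assms(2) \<open>0 < e\<close> by simp
  then show "hausdorff_dim F \<le> ereal t + ereal e"
    unfolding hausdorff_dim_def using assms(2) \<open>0 < e\<close> by (intro Inf_lower) auto
qed

text \<open>An exponent \<open>u\<close> below \<open>t\<close> is itself below all
  \<open>s (\<omega> k)\<close>, so the measure of exponent \<open>u\<close> is positive and
  \<open>u\<close> is excluded from the infimum.\<close>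

lemma packing_dim_F_ge:
  assumes "\<And>k. t \<le> s (\<omega> k)"
  shows "ereal t \<le> packing_dim F"
  unfolding packing_dim_def
proof (rule Inf_greatest, clarify)
  fix u :: real assume u: "0 \<le> u" "packing_measure u F = 0"
  show "ereal t \<le> ereal u"
  proof (rule ccontr)
    assume "\<not> ?thesis"
    then have "u \<le> s (\<omega> k)" for k using assms[of k] by simp
    from packing_measure_F_pos[OF this u(1)] u(2) show False by simp
  qed
qed

lemma hausdorff_dim_F_ge:
  assumes "\<And>k. t \<le> s (\<omega> k)"
  shows "ereal t \<le> hausdorff_dim F"
  unfolding hausdorff_dim_def
proof (rule Inf_greatest, clarify)
  fix u :: real assume u: "0 \<le> u" "hausdorff_measure u F = 0"
  show "ereal t \<le> ereal u"
  proof (rule ccontr)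
    assume "\<not> ?thesis"
    then have "u \<le> s (\<omega> k)" for k using assms[of k] by simp
    from hausdorff_measure_F_pos[OF this u(1)] u(2) show False by simp
  qed
qed

end

lemma SUP_eq_attained:
  fixes f :: "'i \<Rightarrow> 'b::complete_lattice"
  assumes "\<And>i. i \<in> I \<Longrightarrow> f i \<le> c" "j \<in> I" "c \<le> f j"
  shows "(SUP i\<in>I. f i) = c"
  using assms by (intro antisym SUP_least) (auto intro: SUP_upper2)

lemma INF_eq_attained:
  fixes f :: "'i \<Rightarrow> 'b::complete_lattice"
  assumes "\<And>i. i \<in> I \<Longrightarrow> c \<le> f i" "j \<in> I" "f j \<le> c"
  shows "(INF i\<in>I. f i) = c"
  using assms by (intro antisym INF_greatest) (auto intro: INF_lower2)

section \<open>Extreme values over all sequences\<close>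

context similarity_rifs
begin

text \<open>With a negative exponent a single term of the sum would already exceed 1.\<close>

lemma s_nonneg:
  assumes "i \<in> {1..N}"
  shows "0 \<le> s i"
proof (rule ccontr)
  assume neg: "\<not> 0 \<le> s i"
  have "J i \<noteq> {}" using sum_r[OF assms] by auto
  then obtain j where j: "j \<in> J i" by blast
  have r: "0 < r i j" "r i j < 1" using r_bounds[OF assms j] p_pos q_less_1 by auto
  have "1 < r i j powr s i"
    using powr_less_mono'[of "r i j" "s i" 0] r neg by simp
  also have "\<dots> \<le> (\<Sum>j\<in>J i. r i j powr s i)"
    using finite_J[OF assms] j by (intro member_le_sum) auto
  finally show False using sum_r[OF assms] by simp
qed

lemma sup_inf_dimensions:
  assumes "1 \<le> N"
  defines "smin \<equiv> Min (s ` {1..N})" and "smax \<equiv> Max (s ` {1..N})"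
    and "F \<equiv> rifs_attractor K J S"
  shows "0 < (SUP \<omega>\<in>Omega N. packing_measure smax (F \<omega>))"
    and "(SUP \<omega>\<in>Omega N. packing_measure smax (F \<omega>)) < \<infinity>"
    and "(SUP \<omega>\<in>Omega N. packing_dim (F \<omega>)) = ereal smax"
    and "(SUP \<omega>\<in>Omega N. upper_box_dim (F \<omega>)) = ereal smax"
    and "0 < (INF \<omega>\<in>Omega N. hausdorff_measure smin (F \<omega>))"
    and "(INF \<omega>\<in>Omega N. hausdorff_measure smin (F \<omega>)) < \<infinity>"
    and "(INF \<omega>\<in>Omega N. hausdorff_dim (F \<omega>)) = ereal smin"
    and "(INF \<omega>\<in>Omega N. lower_box_dim (F \<omega>)) = ereal smin"
proof -
  have ne: "finite (s ` {1..N})" "s ` {1..N} \<noteq> {}" using assms(1) by auto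
  obtain i where i: "i \<in> {1..N}" "s i = smax" using Max_in[OF ne] by (auto simp: smax_def)
  obtain j where j: "j \<in> {1..N}" "s j = smin" using Min_in[OF ne] by (auto simp: smin_def)
  have smax: "s k \<le> smax" and smin: "smin \<le> s k" if "k \<in> {1..N}" for k
    using that ne by (auto simp: smax_def smin_def)
  have nonneg: "0 \<le> smax" "0 \<le> smin" using s_nonneg i j by metis+
  have const: "(\<lambda>_. k) \<in> Omega N" if "k \<in> {1..N}" for k using that by (simp add: Omega_def)
  \<comment> \<open>Along a constant sequence all exponents coincide, so the upper and lower
    estimates apply with the same \<open>t\<close> and the extreme value is attained.\<close>
  interpret I: similarity_rifs_path K N J S r s V D p q "\<lambda>_. i"
    by unfold_locales (rule const[OF i(1)])
  interpret J: similarity_rifs_path K N J S r s V D p q "\<lambda>_. j"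
    by unfold_locales (rule const[OF j(1)])
  have path: "similarity_rifs_path K N J S r s V D p q \<omega>" if "\<omega> \<in> Omega N" for \<omega>
    by unfold_locales (rule that)
  have \<omega>: "s (\<omega> k) \<le> smax" "smin \<le> s (\<omega> k)" if "\<omega> \<in> Omega N" for \<omega> k
    using that smax smin by (auto simp: Omega_def)

  have "0 < packing_measure smax (F (\<lambda>_. i))"
    unfolding F_def using i nonneg by (intro I.packing_measure_F_pos) auto
  also have "\<dots> \<le> (SUP \<omega>\<in>Omega N. packing_measure smax (F \<omega>))"
    using const[OF i(1)] by (rule SUP_upper)
  finally show "0 < (SUP \<omega>\<in>Omega N. packing_measure smax (F \<omega>))" .
  show "(SUP \<omega>\<in>Omega N. packing_measure smax (F \<omega>)) < \<infinity>"
    unfolding F_def using smax nonneg(1) by (rule packing_measure_bounded)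
  show "(SUP \<omega>\<in>Omega N. packing_dim (F \<omega>)) = ereal smax"
    unfolding F_def
  proof (rule SUP_eq_attained[OF _ const[OF i(1)]])
    show "packing_dim (rifs_attractor K J S \<omega>) \<le> ereal smax" if "\<omega> \<in> Omega N" for \<omega>
      using \<omega>(1)[OF that] nonneg(1) by (rule similarity_rifs_path.packing_dim_F_le[OF path[OF that]])
    show "ereal smax \<le> packing_dim (rifs_attractor K J S (\<lambda>_. i))"
      using i by (intro I.packing_dim_F_ge) auto
  qed
  show "(SUP \<omega>\<in>Omega N. upper_box_dim (F \<omega>)) = ereal smax"
    unfolding F_def
  proof (rule SUP_eq_attained[OF _ const[OF i(1)]])
    show "upper_box_dim (rifs_attractor K J S \<omega>) \<le> ereal smax" if "\<omega> \<in> Omega N" for \<omega>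
      using \<omega>(1)[OF that] nonneg(1) by (rule similarity_rifs_path.upper_box_dim_F_le[OF path[OF that]])
    show "ereal smax \<le> upper_box_dim (rifs_attractor K J S (\<lambda>_. i))"
      using i nonneg by (intro order_trans[OF _ lower_box_dim_le_upper] I.lower_box_dim_F_ge) auto
  qed

  show "0 < (INF \<omega>\<in>Omega N. hausdorff_measure smin (F \<omega>))"
    unfolding F_def using smin nonneg(2) by (rule hausdorff_measure_bounded_below)
  \<comment> \<open>One sequence with finite measure bounds the infimum, whereas the supremum above
    needed a uniform bound.\<close>
  have "(INF \<omega>\<in>Omega N. hausdorff_measure smin (F \<omega>)) \<le> hausdorff_measure smin (F (\<lambda>_. j))"
    using const[OF j(1)] by (rule INF_lower)
  also have "\<dots> \<le> ennreal (2 powr smin) * packing_pre smin (F (\<lambda>_. j))"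
    unfolding F_def using J.bounded_F nonneg(2) by (rule hausdorff_measure_le_packing_pre)
  also have "\<dots> \<le> ennreal (2 powr smin) * ennreal ((2 * D / p) powr smin)"
    unfolding F_def using j nonneg by (intro mult_left_mono J.packing_pre_F_le) auto
  also have "\<dots> < \<infinity>" by (simp add: ennreal_mult[symmetric])
  finally show "(INF \<omega>\<in>Omega N. hausdorff_measure smin (F \<omega>)) < \<infinity>" .
  show "(INF \<omega>\<in>Omega N. hausdorff_dim (F \<omega>)) = ereal smin"
    unfolding F_def
  proof (rule INF_eq_attained[OF _ const[OF j(1)]])
    show "ereal smin \<le> hausdorff_dim (rifs_attractor K J S \<omega>)" if "\<omega> \<in> Omega N" for \<omega>
      using \<omega>(2)[OF that] by (rule similarity_rifs_path.hausdorff_dim_F_ge[OF path[OF that]])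
    show "hausdorff_dim (rifs_attractor K J S (\<lambda>_. j)) \<le> ereal smin"
      using j nonneg by (intro J.hausdorff_dim_F_le) auto
  qed
  show "(INF \<omega>\<in>Omega N. lower_box_dim (F \<omega>)) = ereal smin"
    unfolding F_def
  proof (rule INF_eq_attained[OF _ const[OF j(1)]])
    show "ereal smin \<le> lower_box_dim (rifs_attractor K J S \<omega>)" if "\<omega> \<in> Omega N" for \<omega>
      using \<omega>(2)[OF that] nonneg(2) by (rule similarity_rifs_path.lower_box_dim_F_ge[OF path[OF that]])
    show "lower_box_dim (rifs_attractor K J S (\<lambda>_. j)) \<le> ereal smin"
      using j nonneg by (intro order_trans[OF lower_box_dim_le_upper] J.upper_box_dim_F_le) auto
  qed
qed

end

theorem theorem2p4:
  fixes K :: "'a::euclidean_space set"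
    and N :: nat
    and J :: "nat \<Rightarrow> nat set"
    and S :: "nat \<Rightarrow> nat \<Rightarrow> 'a \<Rightarrow> 'a"
    and r :: "nat \<Rightarrow> nat \<Rightarrow> real"
    and s :: "nat \<Rightarrow> real"
  assumes K: "compact K"
    and N: "N \<ge> 1"
    and J: "\<And>i. i \<in> {1..N} \<Longrightarrow> finite (J i) \<and> J i \<noteq> {}"
    and S_sim: "\<And>i j x y. i \<in> {1..N} \<Longrightarrow> j \<in> J i \<Longrightarrow> dist (S i j x) (S i j y) = r i j * dist x y"
    and r: "\<And>i j. i \<in> {1..N} \<Longrightarrow> j \<in> J i \<Longrightarrow> 0 < r i j \<and> r i j < 1"
    and S_K: "\<And>i j. i \<in> {1..N} \<Longrightarrow> j \<in> J i \<Longrightarrow> S i j ` K \<subseteq> K"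
    and s: "\<And>i. i \<in> {1..N} \<Longrightarrow> (\<Sum>j\<in>J i. r i j powr s i) = 1"
    and UOSC: "uniform_osc K N J S"
  defines "smin \<equiv> Min (s ` {1..N})"
    and "smax \<equiv> Max (s ` {1..N})"
    and "F \<equiv> rifs_attractor K J S"
  shows "(0 < (SUP \<omega>\<in>Omega N. packing_measure smax (F \<omega>)) \<and> (SUP \<omega>\<in>Omega N. packing_measure smax (F \<omega>)) < \<infinity>) \<and>
    ((SUP \<omega>\<in>Omega N. packing_dim (F \<omega>)) = ereal smax \<and> (SUP \<omega>\<in>Omega N. upper_box_dim (F \<omega>)) = ereal smax) \<and>
    (0 < (INF \<omega>\<in>Omega N. hausdorff_measure smin (F \<omega>)) \<and> (INF \<omega>\<in>Omega N. hausdorff_measure smin (F \<omega>)) < \<infinity>) \<and>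
    ((INF \<omega>\<in>Omega N. hausdorff_dim (F \<omega>)) = ereal smin \<and> (INF \<omega>\<in>Omega N. lower_box_dim (F \<omega>)) = ereal smin)"
proof -
  obtain V where V: "open V" "V \<noteq> {}" "V \<subseteq> K" and
    osc: "\<forall>i\<in>{1..N}. (\<Union>j\<in>J i. S i j ` V) \<subseteq> V \<and> disjoint_family_on (\<lambda>j. S i j ` V) (J i)"
    using UOSC unfolding uniform_osc_def by (elim exE conjE) (rule that)
  define D where "D = diameter K + 1"
  have D: "0 < D" "\<And>x y. x \<in> K \<Longrightarrow> y \<in> K \<Longrightarrow> dist x y \<le> D"
    using diameter_ge_0[of K] diameter_bounded_bound[of K] compact_imp_bounded[OF K]
    by (force simp: D_def)+
  \<comment> \<open>There are finitely many ratios, so their minimum and maximum still lie strictly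
    between 0 and 1.\<close>
  define R where "R = (\<Union>i\<in>{1..N}. r i ` J i)"
  have R: "finite R" "\<And>c. c \<in> R \<Longrightarrow> 0 < c \<and> c < 1"
    using J r by (auto simp: R_def)
  have R_ne: "R \<noteq> {}"
    using J[of 1] N by (auto simp: R_def)
  have rR: "Min R \<le> r i j \<and> r i j \<le> Max R" if "i \<in> {1..N}" "j \<in> J i" for i j
    using R(1) that by (auto simp: R_def intro!: Min_le Max_ge)
  interpret similarity_rifs K N J S r s V D "Min R" "Max R"
  proof
    show "0 < Min R" "Max R < 1" using R(2)[OF Min_in[OF R(1) R_ne]] R(2)[OF Max_in[OF R(1) R_ne]] by auto
    show "finite (J i)" if "i \<in> {1..N}" for i using J[OF that] ..
    show "S i j ` V \<subseteq> V" if "i \<in> {1..N}" "j \<in> J i" for i j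
      using bspec[OF osc that(1)] that(2) by (simp add: UN_subset_iff)
    show "disjoint_family_on (\<lambda>j. S i j ` V) (J i)" if "i \<in> {1..N}" for i
      using bspec[OF osc that] ..
  qed (fact K S_sim S_K s V D rR)+
  show ?thesis
    unfolding smin_def smax_def F_def by (intro conjI sup_inf_dimensions[OF N])
qed

end
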